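(* Among all trees with a given tree degree sequence $(d_1,\ldots,d_n)$, a greedy caterpillar with that degree sequence has the minimum connective eccentricity index.
   Context: For a simple connected graph $G$, the connective eccentricity index is $\xi^{ce}(G)=\sum_{u\in V(G)}\frac{d(u)}{\varepsilon(u)}$, where $d(u)$ is the degree of $u$ and $\varepsilon(u)$ is the eccentricity of $u$ (the maximum distance from $u$ to any other vertex). A sequence $(d_1,\ldots,d_n)$ of positive integers is a tree degree sequence if and only if $\sum_{i=1}^n d_i=2(n-1)$. For $n\geq 3$, let $(d_1,d_2,\ldots,d_n)$ be the non-increasing degree sequence of a tree with $d_k>1$ and $d_{k+1}=1$ for some $k\in\{1,\ldots,n-2\}$. A greedy caterpillar for this sequence is constructed as follows: start with a path $P=z_1z_2\cdots z_k$; let $\phi:\{z_i\}_{i=1}^k\to\{d_i\}_{i=1}^k$ be a one-to-one assignment such that for all $i,j$, if $\varepsilon_P(z_i)>\varepsilon_P(z_j)$ then $\phi(z_i)\geq\phi(z_j)$; for each $i\in\{2,\ldots,k-1\}$ attach $\phi(z_i)-2$ pendant vertices to $z_i$, and for $i\in\{1,k\}$ attach $\phi(z_i)-1$ pendant vertices to $z_i$. (Greedy caterpillars need not be unique for a given degree sequence.)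
   Formalization: For k = 1 the stated construction (attach φ(z_1)−1 pendants) does not give the degree sequence, e.g. (2,1,1) yields a single edge; here φ(z_1) = d_1 pendant vertices are attached to z_1 instead, giving the star. *)

theory Defs
  imports Complex_Main "HOL-Library.Multiset" "Graph_Theory.Graph_Theory"
begin

text \<open>
  Finite simple graphs are \<^locale>\<open>pair_graph\<close>s: an undirected edge is represented by the two
  opposite arcs joining its ends, so the degree of a vertex is its out-degree.
\<close>

definition degree :: "'a pair_pre_digraph \<Rightarrow> 'a \<Rightarrow> nat" where
  "degree G u = out_degree (with_proj G) u"

text \<open>
  The constant \<open>tree\<close> of \<^theory>\<open>Graph_Theory.Digraph_Component\<close> is meant for oriented graphs: in a
  symmetric digraph an edge traversed back and forth counts as a cycle of length two there. The
  cycles of the undirected graph are exactly those of length at least three.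
\<close>

definition sym_tree :: "'a pair_pre_digraph \<Rightarrow> bool" where
  "sym_tree G \<longleftrightarrow> pair_graph G \<and> connected (with_proj G) \<and>
     (\<nexists>p. pre_digraph.cycle (with_proj G) p \<and> length p \<ge> 3)"

definition distance :: "'a pair_pre_digraph \<Rightarrow> 'a \<Rightarrow> 'a \<Rightarrow> real" where
  "distance G u v = real_of_ereal (wf_digraph.\<mu> (with_proj G) (\<lambda>_. 1) u v)"

text \<open>
  The maximum includes \<open>v = u\<close>, which contributes \<open>0\<close>; this only matters for a one-vertex graph,
  where the eccentricity becomes \<open>0\<close> instead of the maximum of the empty set.
\<close>

definition eccentricity :: "'a pair_pre_digraph \<Rightarrow> 'a \<Rightarrow> real" where
  "eccentricity G u = Max (distance G u ` pverts G)"

definition connective_eccentricity_index :: "'a pair_pre_digraph \<Rightarrow> real" where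
  "connective_eccentricity_index G = (\<Sum>u\<in>pverts G. real (degree G u) / eccentricity G u)"

definition has_degree_sequence :: "'a pair_pre_digraph \<Rightarrow> nat list \<Rightarrow> bool" where
  "has_degree_sequence G ds \<longleftrightarrow> image_mset (degree G) (mset_set (pverts G)) = mset ds"

text \<open>Every finite tree has an isomorphic copy with vertices in \<^typ>\<open>nat\<close>.\<close>

definition tree_degree_sequence :: "nat list \<Rightarrow> bool" where
  "tree_degree_sequence ds \<longleftrightarrow>
     (\<exists>T :: nat pair_pre_digraph. sym_tree T \<and> has_degree_sequence T ds)"

definition path_graph :: "'a list \<Rightarrow> 'a pair_pre_digraph" where
  "path_graph zs = \<lparr> pverts = set zs,
     parcs = (\<Union>i\<in>{i. Suc i < length zs}. {(zs ! i, zs ! Suc i), (zs ! Suc i, zs ! i)}) \<rparr>"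

text \<open>\<open>L z\<close> is the set of new vertices to be joined to \<open>z\<close>.\<close>

definition attach_pendants :: "'a pair_pre_digraph \<Rightarrow> ('a \<Rightarrow> 'a set) \<Rightarrow> 'a pair_pre_digraph" where
  "attach_pendants G L = \<lparr> pverts = pverts G \<union> (\<Union>z\<in>pverts G. L z),
     parcs = parcs G \<union> (\<Union>z\<in>pverts G. \<Union>x\<in>L z. {(z, x), (x, z)}) \<rparr>"

text \<open>
  Here \<open>i\<close> is a \<open>0\<close>-based position on a path with \<open>k\<close> vertices, and \<open>d\<close> is the degree the vertex at
  that position is to receive. For \<open>k = 1\<close> the vertex has no neighbour on the path, so
  all \<open>d\<close> of its neighbours are pendant and the construction yields a star.
\<close>

definition num_pendants :: "nat \<Rightarrow> nat \<Rightarrow> nat \<Rightarrow> nat" where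
  "num_pendants k i d =
     (if k = 1 then d else if i = 0 \<or> i = k - 1 then d - 1 else d - 2)"

text \<open>
  The path is \<open>zs\<close>. The equation between multisets says that \<open>\<phi>\<close> is a one-to-one assignment of
  the entries \<open>d\<^sub>1, \<dots>, d\<^sub>k\<close>, counted with multiplicity, to its vertices.
\<close>

definition greedy_caterpillar :: "nat list \<Rightarrow> nat \<Rightarrow> 'a pair_pre_digraph \<Rightarrow> bool" where
  "greedy_caterpillar ds k G \<longleftrightarrow>
     (\<exists>(zs :: 'a list) (\<phi> :: 'a \<Rightarrow> nat) (L :: 'a \<Rightarrow> 'a set).
        length zs = k \<and> distinct zs \<and>
        image_mset \<phi> (mset zs) = mset (take k ds) \<and>
        (\<forall>u\<in>set zs. \<forall>v\<in>set zs.
           eccentricity (path_graph zs) u > eccentricity (path_graph zs) v \<longrightarrow> \<phi> u \<ge> \<phi> v) \<and>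
        (\<forall>i<k. finite (L (zs ! i)) \<and> card (L (zs ! i)) = num_pendants k i (\<phi> (zs ! i))) \<and>
        (\<forall>u\<in>set zs. L u \<inter> set zs = {}) \<and>
        (\<forall>u\<in>set zs. \<forall>v\<in>set zs. u \<noteq> v \<longrightarrow> L u \<inter> L v = {}) \<and>
        G = attach_pendants (path_graph zs) L)"

end

theory Submission
  imports Defs
begin

text \<open>
  Of the neighbours of a vertex \<open>v\<close> of a tree, at most one fails to have eccentricity
  \<open>\<epsilon>(v) + 1\<close>: a path from \<open>v\<close> to a farthest vertex avoids all other neighbours, and extends
  to them. Summing \<open>1/\<epsilon>\<close> over the ends of all edges therefore gives
  \<open>\<xi> \<ge> (\<Sum>v. (d(v) - 1) g(\<epsilon>(v))) + c\<close> with \<open>g(e) = 1/e + 1/(e + 1)\<close>, where \<open>c\<close> comes from the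
  center and is at least \<open>1/\<lceil>D/2\<rceil> + 1/(\<lfloor>D/2\<rfloor> + 1)\<close> for a tree of diameter \<open>D\<close>. Leaves do not
  contribute to the sum. The inner vertices of a diametral path show that \<open>D \<le> k + 1\<close> and that
  the eccentricities of the \<open>k\<close> internal vertices are dominated by those of the spine of a
  caterpillar, which are \<open>max(i, k + 1 - i)\<close> for \<open>1 \<le> i \<le> k\<close>. As \<open>g\<close> is decreasing, the sum is
  smallest when the eccentricities are those of the spine and large degrees meet large
  eccentricities, and the greedy caterpillar attains the resulting bound.
\<close>

section \<open>Rearrangement\<close>

text \<open>Points are matched one at a time, each with a point of equal value. This later pairs the
  spine vertices of the caterpillar with the internal vertices of a competing tree so that degrees
  agree.\<close>

lemma image_mset_eq_imp_bij_betw: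
  assumes "finite A" "finite B"
    and "image_mset f (mset_set A) = image_mset g (mset_set B)"
  shows "\<exists>h. bij_betw h A B \<and> (\<forall>x\<in>A. g (h x) = f x)"
  using assms
proof (induction A arbitrary: B rule: finite_induct)
  case empty
  then have "B = {}" by (auto simp: mset_set_empty_iff)
  then show ?case by (auto simp: bij_betw_def)
next
  case (insert a A)
  have "f a \<in># image_mset g (mset_set B)"
    using insert.prems(2)[symmetric] insert.hyps by simp
  then obtain b where b: "b \<in> B" "g b = f a"
    using insert.prems(1) by auto
  have "mset_set B = add_mset b (mset_set (B - {b}))"
    using b insert.prems(1) by (simp add: mset_set.remove)
  then have "image_mset f (mset_set A) = image_mset g (mset_set (B - {b}))"
    using insert.prems(2) insert.hyps b by simp
  then obtain h where h: "bij_betw h A (B - {b})" "\<forall>x\<in>A. g (h x) = f x"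
    using insert.IH[of "B - {b}"] insert.prems(1) by auto
  have "bij_betw (h(a := b)) A (B - {b})"
    using h(1) insert.hyps(2) by (subst bij_betw_cong[of A _ h]) auto
  then have "bij_betw (h(a := b)) (A \<union> {a}) ((B - {b}) \<union> {b})"
    by (rule bij_betw_combine) (auto simp: bij_betw_def)
  moreover have "A \<union> {a} = insert a A" "(B - {b}) \<union> {b} = B" using b by auto
  ultimately show ?case using h(2) b insert.hyps(2)
    by (intro exI[of _ "h(a := b)"] conjI) (auto simp del: fun_upd_apply, auto)
qed

text \<open>After cancelling \<open>P \<inter> Q\<close>, the largest weight \<open>M\<close> in
  \<open>P - Q\<close> separates the two sides: weights in \<open>Q - P\<close> are at least
  \<open>M\<close>, and there are at least as many of them. As \<open>M\<close> is nonnegative, the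
  comparison of counts carries over to the sums.\<close>

lemma sum_smallest_le:
  fixes a :: "'i \<Rightarrow> real"
  assumes "finite I" "P \<subseteq> I" "Q \<subseteq> I" "card P \<le> card Q"
    and nonneg: "\<And>i. i \<in> I \<Longrightarrow> 0 \<le> a i"
    and smallest: "\<And>i j. i \<in> P \<Longrightarrow> j \<in> I - P \<Longrightarrow> a i \<le> a j"
  shows "sum a P \<le> sum a Q"
proof -
  have fin: "finite P" "finite Q" using assms finite_subset by auto
  have "card P = card (P \<inter> Q) + card (P - Q)" "card Q = card (P \<inter> Q) + card (Q - P)"
    using fin by (metis card_Int_Diff Int_commute)+
  then have card: "card (P - Q) \<le> card (Q - P)" using assms(4) by simp
  have "sum a (P - Q) \<le> sum a (Q - P)"
  proof (cases "P - Q = {}")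
    case True
    then show ?thesis using nonneg assms(3) by (simp only: True sum.empty) (auto intro: sum_nonneg)
  next
    case False
    define M where "M = Max (a ` (P - Q))"
    have M: "a i \<le> M" if "i \<in> P - Q" for i using that fin by (simp add: M_def)
    have "M \<in> a ` (P - Q)" unfolding M_def using False fin by (intro Max_in) auto
    then obtain i where i: "i \<in> P - Q" "M = a i" by auto
    have "sum a (P - Q) \<le> real (card (P - Q)) * M" using M by (rule sum_bounded_above)
    also have "\<dots> \<le> real (card (Q - P)) * M"
      using card i nonneg assms(2) by (intro mult_right_mono) auto
    also have "\<dots> \<le> sum a (Q - P)"
      using i smallest assms(3) by (intro sum_bounded_below) auto
    finally show ?thesis .
  qed
  moreover have "sum a P = sum a (P \<inter> Q) + sum a (P - Q)"
    using fin by (simp add: sum.Int_Diff)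
  moreover have "sum a Q = sum a (P \<inter> Q) + sum a (Q - P)"
    using fin by (metis sum.Int_Diff Int_commute)
  ultimately show ?thesis by simp
qed

text \<open>Layer-cake decomposition of \<open>g\<close> reduces the claim to sums over sublevel sets.\<close>

lemma sum_antitone_rearrangement:
  fixes a :: "'i \<Rightarrow> real" and g :: "nat \<Rightarrow> real" and e f :: "'i \<Rightarrow> nat"
  assumes I: "finite I"
    and nonneg: "\<And>i. i \<in> I \<Longrightarrow> 0 \<le> a i"
    and mono: "\<And>i j. i \<in> I \<Longrightarrow> j \<in> I \<Longrightarrow> e i < e j \<Longrightarrow> a i \<le> a j"
    and card: "\<And>t. card {i \<in> I. e i \<le> t} \<le> card {i \<in> I. f i \<le> t}"
    and ge: "\<And>i. i \<in> I \<Longrightarrow> m \<le> e i" "\<And>i. i \<in> I \<Longrightarrow> m \<le> f i"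
    and anti: "\<And>s. m \<le> s \<Longrightarrow> g (Suc s) \<le> g s"
  shows "(\<Sum>i\<in>I. a i * g (e i)) \<le> (\<Sum>i\<in>I. a i * g (f i))"
proof -
  \<comment> \<open>\<open>N\<close> bounds the values of both \<open>e\<close> and
    \<open>f\<close>, so the two layer sums run over the same range and share the term
    \<open>sum a I * g N\<close>.\<close>
  define N where "N = m + (\<Sum>i\<in>I. e i + f i)"
  have N: "e i \<le> N" "f i \<le> N" if "i \<in> I" for i
    using member_le_sum[OF that, of "\<lambda>i. e i + f i"] I by (auto simp: N_def)
  have layers: "(\<Sum>i\<in>I. a i * g (u i)) = sum a I * g N +
      (\<Sum>t = m..<N. (g t - g (Suc t)) * sum a {i \<in> I. u i \<le> t})"
    if u: "\<And>i. i \<in> I \<Longrightarrow> m \<le> u i \<and> u i \<le> N" for u :: "'i \<Rightarrow> nat"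
  proof -
    have g: "g s = g N + (\<Sum>t = m..<N. if s \<le> t then g t - g (Suc t) else 0)"
      if "m \<le> s" "s \<le> N" for s
    proof -
      have "(\<Sum>t = m..<N. if s \<le> t then g t - g (Suc t) else 0) = (\<Sum>t = s..<N. g t - g (Suc t))"
        using that by (intro sum.mono_neutral_cong_right) auto
      also have "\<dots> = - (\<Sum>t = s..<N. g (Suc t) - g t)"
        by (simp add: sum_negf[symmetric])
      also have "\<dots> = g s - g N"
        using that by (simp add: sum_Suc_diff')
      finally show ?thesis by simp
    qed
    have "a i * g (u i) =
        a i * g N + (\<Sum>t = m..<N. if u i \<le> t then (g t - g (Suc t)) * a i else 0)"
      if "i \<in> I" for i
      by (subst g) (use u[OF that] in \<open>auto simp: distrib_left sum_distrib_left intro!: sum.cong\<close>)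
    then have "(\<Sum>i\<in>I. a i * g (u i)) =
        (\<Sum>i\<in>I. a i * g N + (\<Sum>t = m..<N. if u i \<le> t then (g t - g (Suc t)) * a i else 0))"
      by (intro sum.cong refl)
    also have "\<dots> = sum a I * g N +
        (\<Sum>t = m..<N. \<Sum>i\<in>I. if u i \<le> t then (g t - g (Suc t)) * a i else 0)"
      unfolding sum.distrib sum_distrib_right by (subst (2) sum.swap) (rule refl)
    finally show ?thesis
      using I by (auto simp: sum.inter_filter sum_distrib_left intro!: sum.cong)
  qed
  \<comment> \<open>By \<open>mono\<close> the weights on a sublevel set of \<open>e\<close> are the
    smallest ones, and by \<open>card\<close> this set is no larger than that of
    \<open>f\<close>.\<close>
  have "sum a {i \<in> I. e i \<le> t} \<le> sum a {i \<in> I. f i \<le> t}" for t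
    by (rule sum_smallest_le[OF I]) (use nonneg mono card in auto)
  then have "(\<Sum>t = m..<N. (g t - g (Suc t)) * sum a {i \<in> I. e i \<le> t}) \<le>
      (\<Sum>t = m..<N. (g t - g (Suc t)) * sum a {i \<in> I. f i \<le> t})"
    using anti by (intro sum_mono mult_left_mono) auto
  then show ?thesis
    using layers[of e] layers[of f] N ge by auto
qed

section \<open>Eccentricities in trees\<close>

text \<open>
  A tree seen through its distance function. Acyclicity enters only through \<open>branch\<close>: of two
  different neighbours of \<open>v\<close>, at most one lies on the way from \<open>v\<close> to \<open>x\<close>.
\<close>

locale tree_distance =
  fixes V :: "'a set" and E :: "'a rel" and d :: "'a \<Rightarrow> 'a \<Rightarrow> nat"
  assumes finite_V: "finite V" and V_nonempty: "V \<noteq> {}"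
    and E_subset: "(u, v) \<in> E \<Longrightarrow> u \<in> V"
    and E_sym: "(u, v) \<in> E \<Longrightarrow> (v, u) \<in> E"
    and E_irrefl: "(u, u) \<notin> E"
    and d_self: "u \<in> V \<Longrightarrow> d u u = 0"
    and d_sym: "u \<in> V \<Longrightarrow> v \<in> V \<Longrightarrow> d u v = d v u"
    and d_step: "(v, w) \<in> E \<Longrightarrow> x \<in> V \<Longrightarrow> d w x \<le> Suc (d v x)"
    and d_next: "u \<in> V \<Longrightarrow> x \<in> V \<Longrightarrow> u \<noteq> x \<Longrightarrow> \<exists>w. (u, w) \<in> E \<and> d u x = Suc (d w x)"
    and branch: "(v, w) \<in> E \<Longrightarrow> (v, w') \<in> E \<Longrightarrow> w \<noteq> w' \<Longrightarrow> x \<in> V \<Longrightarrow>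
      d w x = Suc (d v x) \<or> d w' x = Suc (d v x)"
begin

definition deg :: "'a \<Rightarrow> nat" where
  "deg v = card (E `` {v})"

definition ecc :: "'a \<Rightarrow> nat" where
  "ecc v = Max (d v ` V)"

text \<open>With the tree rooted at its center, which is a vertex or an edge, these are the usual
  children of \<open>v\<close>.\<close>

definition children :: "'a \<Rightarrow> 'a set" where
  "children v = {w. (v, w) \<in> E \<and> ecc w = Suc (ecc v)}"

definition internal :: "'a set" where
  "internal = {v \<in> V. 2 \<le> deg v}"

definition diam :: nat where
  "diam = Max (ecc ` V)"

lemma E_subset': "(u, v) \<in> E \<Longrightarrow> v \<in> V"
  using E_sym E_subset by blast

lemma E_subset_Times: "E \<subseteq> V \<times> V"
  using E_subset E_subset' by auto

lemma finite_children: "finite (children v)"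
  by (rule finite_subset[OF _ finite_V]) (auto simp: children_def dest: E_subset')

lemma finite_E: "finite E"
  using E_subset_Times finite_V finite_subset by blast

lemma finite_nbrs: "finite (E `` {v})"
  by (rule finite_subset[OF _ finite_V]) (auto dest: E_subset')

lemma d_pos: "u \<in> V \<Longrightarrow> x \<in> V \<Longrightarrow> u \<noteq> x \<Longrightarrow> 0 < d u x"
  using d_next by fastforce

text \<open>Each step towards \<open>x\<close> changes \<open>l\<close> by at most one. This is the
  tool for lower bounds on distances in a concrete tree.\<close>

lemma potential_le_d:
  fixes l :: "'a \<Rightarrow> int"
  assumes "\<And>v w. (v, w) \<in> E \<Longrightarrow> \<bar>l v - l w\<bar> \<le> 1" and "u \<in> V" "x \<in> V"
  shows "\<bar>l u - l x\<bar> \<le> int (d u x)"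
  using assms(2)
proof (induction "d u x" arbitrary: u)
  case 0
  then show ?case using d_pos[of u x] assms(3) by (cases "u = x") auto
next
  case (Suc n)
  then have "u \<noteq> x" using d_self by auto
  then obtain w where w: "(u, w) \<in> E" "d u x = Suc (d w x)"
    using d_next Suc.prems assms(3) by blast
  then have "\<bar>l w - l x\<bar> \<le> int (d w x)" using Suc E_subset' by auto
  moreover have "\<bar>l u - l w\<bar> \<le> 1" using assms(1) w by auto
  ultimately show ?case using w by linarith
qed

lemma d_pendant:
  assumes "E `` {x} = {z}" "y \<in> V" "y \<noteq> x"
  shows "d x y = Suc (d z y)"
  using assms d_next[of x y] E_subset by fastforce

lemma d_le_ecc: "x \<in> V \<Longrightarrow> d v x \<le> ecc v"
  unfolding ecc_def using finite_V by (intro Max_ge) auto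

lemma ecc_attained: "\<exists>x\<in>V. d v x = ecc v"
proof -
  have "ecc v \<in> d v ` V"
    unfolding ecc_def using finite_V V_nonempty by (intro Max_in) auto
  then show ?thesis by auto
qed

lemma ecc_le: "(\<And>x. x \<in> V \<Longrightarrow> d v x \<le> b) \<Longrightarrow> ecc v \<le> b"
  using ecc_attained[of v] by metis

lemma ecc_step: "(v, w) \<in> E \<Longrightarrow> ecc w \<le> Suc (ecc v)"
  by (rule ecc_le) (meson d_step d_le_ecc Suc_le_mono order_trans)

text \<open>Apply \<open>branch\<close> to a vertex \<open>x\<close> farthest from \<open>v\<close>:
  the neighbour that is not on the way to \<open>x\<close> has distance \<open>ecc v + 1\<close>
  from it, and \<open>ecc_step\<close> allows no more.\<close>

lemma ecc_branch:
  assumes "(v, w) \<in> E" "(v, w') \<in> E" "w \<noteq> w'"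
  shows "ecc w = Suc (ecc v) \<or> ecc w' = Suc (ecc v)"
proof -
  obtain x where x: "x \<in> V" "d v x = ecc v" using ecc_attained by blast
  then show ?thesis
    using branch[OF assms x(1)] d_le_ecc[OF x(1), of w] d_le_ecc[OF x(1), of w']
      ecc_step[OF assms(1)] ecc_step[OF assms(2)] by linarith
qed

section \<open>Counting edges, and the index as a sum over edges\<close>

lemma sum_deg: "(\<Sum>v\<in>V. deg v) = card E"
proof -
  have "E = Sigma V (\<lambda>v. E `` {v})" using E_subset by auto
  then have "card E = card (Sigma V (\<lambda>v. E `` {v}))" by simp
  also have "\<dots> = (\<Sum>v\<in>V. card (E `` {v}))" using finite_V finite_nbrs by (intro card_SigmaI) auto
  finally show ?thesis by (simp add: deg_def)
qed

text \<open>Rooting the tree at \<open>c\<close>, every edge joins a unique non-root vertex to its parent.\<close>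

lemma handshake: "(\<Sum>v\<in>V. deg v) + 2 = 2 * card V"
proof -
  obtain c where c: "c \<in> V" using V_nonempty by blast
  \<comment> \<open>\<open>U\<close> consists of the arcs pointing towards the root
    \<open>c\<close>. By \<open>branch\<close>, two neighbours of a vertex cannot both be nearer to
    \<open>c\<close>, so the parent is unique.\<close>
  define U where "U = {(v, w) \<in> E. d v c = Suc (d w c)}"
  have fin: "finite U" unfolding U_def by (rule finite_subset[OF _ finite_E]) auto
  have "bij_betw fst U (V - {c})"
  proof (rule bij_betw_imageI)
    show "inj_on fst U"
    proof (rule inj_onI)
      fix p q assume "p \<in> U" "q \<in> U" "fst p = fst q"
      then obtain v w w' where *: "p = (v, w)" "q = (v, w')" "(v, w) \<in> E" "(v, w') \<in> E"
        "d v c = Suc (d w c)" "d v c = Suc (d w' c)"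
        by (cases p, cases q) (auto simp: U_def)
      have "w = w'"
      proof (rule ccontr)
        assume "w \<noteq> w'"
        then have "d w c = Suc (d v c) \<or> d w' c = Suc (d v c)"
          using branch * c by blast
        then show False using *(5,6) by linarith
      qed
      with * show "p = q" by simp
    qed
    show "fst ` U = V - {c}"
    proof
      show "fst ` U \<subseteq> V - {c}" using d_self[OF c] E_subset by (auto simp: U_def)
      show "V - {c} \<subseteq> fst ` U"
      proof
        fix v assume "v \<in> V - {c}"
        then obtain w where "(v, w) \<in> U" using d_next[of v c] c by (auto simp: U_def)
        then show "v \<in> fst ` U" by force
      qed
    qed
  qed
  then have card_U: "card U = card V - 1" using c finite_V by (simp add: bij_betw_same_card)
  \<comment> \<open>No edge joins vertices at equal distance from \<open>c\<close>: every neighbour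
    of \<open>v\<close> other than the parent \<open>p\<close> is one step farther by
    \<open>branch\<close>.\<close>
  have dist: "d v c = Suc (d w c) \<or> d w c = Suc (d v c)" if vw: "(v, w) \<in> E" for v w
  proof (cases "v = c")
    case True
    then have "w \<noteq> c" using vw E_irrefl by auto
    then show ?thesis using True d_step[OF vw c] d_self[OF c] d_pos[of w c] E_subset'[OF vw] c
      by auto
  next
    case False
    then obtain p where p: "(v, p) \<in> E" "d v c = Suc (d p c)" using d_next E_subset vw c by blast
    then show ?thesis using branch[OF p(1) vw _ c] by (cases "p = w") auto
  qed
  have "E = U \<union> U\<inverse>"
    using dist E_sym by (auto simp: U_def)
  moreover have "U \<inter> U\<inverse> = {}" by (auto simp: U_def)
  ultimately have "card E = card U + card (U\<inverse>)"
    using fin by (metis card_Un_disjoint finite_converse)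
  then have "card E = 2 * (card V - 1)" using card_U by simp
  moreover have "0 < card V" using c finite_V by (auto simp: card_gt_0_iff)
  ultimately show ?thesis using sum_deg by simp
qed

text \<open>Two neighbours outside \<open>children v\<close> would contradict
  \<open>ecc_branch\<close>.\<close>

lemma deg_le_card_children: "deg v - 1 \<le> card (children v)"
proof -
  have "card (E `` {v} - children v) \<le> 1"
    using ecc_branch finite_nbrs
    by (subst One_nat_def, subst card_le_Suc0_iff_eq) (auto simp: children_def)
  moreover have "deg v \<le> card (children v) + card (E `` {v} - children v)"
    unfolding deg_def using finite_nbrs
    by (intro order_trans[OF card_mono card_Un_le]) (auto simp: finite_children)
  ultimately show ?thesis by simp
qed

text \<open>Write the index as the sum of \<open>1 / ecc v\<close> over all arcs
  \<open>(v, w)\<close>. An arc to a child together with its reverse contributes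
  \<open>1 / ecc v + 1 / Suc (ecc v)\<close>; arcs between vertices of equal eccentricity are kept
  apart and occur in both directions.\<close>

lemma index_eq:
  "(\<Sum>v\<in>V. real (deg v) / ecc v) =
    (\<Sum>v\<in>V. card (children v) * (1 / ecc v + 1 / Suc (ecc v))) +
    (\<Sum>(v, w)\<in>{(v, w)\<in>E. ecc v = ecc w}. 1 / ecc v)"
proof -
  define D where "D = {(v, w)\<in>E. ecc w = Suc (ecc v)}"
  define L where "L = {(v, w)\<in>E. ecc v = ecc w}"
  have fin: "finite D" "finite L" using finite_E by (auto simp: D_def L_def elim: finite_subset[rotated])
  \<comment> \<open>Eccentricities of adjacent vertices differ by at most one, so \<open>D\<close>,
    its converse and \<open>L\<close> exhaust \<open>E\<close>.\<close>
  have nonchild: "ecc w \<noteq> Suc (ecc v) \<Longrightarrow> (v, w) \<in> E \<Longrightarrow> ecc v = ecc w \<or> ecc v = Suc (ecc w)" for v w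
    using ecc_step[of v w] ecc_step[OF E_sym, of v w] by linarith
  have E: "E = (D \<union> D\<inverse>) \<union> L"
    using nonchild E_sym by (auto simp: D_def L_def)
  have disj: "(D \<union> D\<inverse>) \<inter> L = {}" "D \<inter> D\<inverse> = {}" by (auto simp: D_def L_def)
  let ?f = "\<lambda>(v, w). 1 / real (ecc v)"
  have "(\<Sum>v\<in>V. real (deg v) / ecc v) = (\<Sum>v\<in>V. \<Sum>w\<in>E `` {v}. 1 / ecc v)"
    by (simp add: deg_def)
  also have "\<dots> = sum ?f (Sigma V (\<lambda>v. E `` {v}))"
    using finite_V finite_nbrs by (subst sum.Sigma) auto
  also have "Sigma V (\<lambda>v. E `` {v}) = E" using E_subset by auto
  also have "sum ?f E = sum ?f D + sum ?f (D\<inverse>) + sum ?f L"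
    using fin disj by (subst E) (simp add: sum.union_disjoint)
  also have "sum ?f (D\<inverse>) = (\<Sum>(v, w)\<in>D. 1 / ecc w)"
    by (rule sum.reindex_bij_witness[of _ prod.swap prod.swap]) auto
  also have "sum ?f D + (\<Sum>(v, w)\<in>D. 1 / ecc w) = (\<Sum>(v, w)\<in>D. 1 / ecc v + 1 / Suc (ecc v))"
    by (simp add: sum.distrib[symmetric]) (rule sum.cong, auto simp: D_def)
  also have "D = Sigma V children" using E_subset by (auto simp: D_def children_def)
  also have "(\<Sum>(v, w)\<in>Sigma V children. 1 / ecc v + 1 / Suc (ecc v)) =
      (\<Sum>v\<in>V. \<Sum>w\<in>children v. 1 / ecc v + 1 / Suc (ecc v))"
    using finite_V finite_nbrs by (subst sum.Sigma) (auto simp: finite_children)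
  finally show ?thesis by (simp add: L_def)
qed

section \<open>Geodesics and diametral paths\<close>

lemma ecc_le_diam: "v \<in> V \<Longrightarrow> ecc v \<le> diam"
  unfolding diam_def using finite_V by (intro Max_ge) auto

lemma d_le_diam: "v \<in> V \<Longrightarrow> x \<in> V \<Longrightarrow> d v x \<le> diam"
  using d_le_ecc ecc_le_diam order_trans by blast

lemma geodesic:
  assumes "x \<in> V" "y \<in> V"
  shows "\<exists>p. p 0 = x \<and> p (d x y) = y \<and> (\<forall>i\<le>d x y. p i \<in> V \<and> d (p i) y = d x y - i) \<and>
    (\<forall>i<d x y. (p i, p (Suc i)) \<in> E)"
  using assms
proof (induction "d x y" arbitrary: x)
  case 0
  then have "x = y" using d_pos by fastforce
  then show ?case using 0 by (intro exI[of _ "\<lambda>_. y"]) auto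
next
  case (Suc n)
  then have "x \<noteq> y" using d_self by auto
  then obtain w where w: "(x, w) \<in> E" "d x y = Suc (d w y)" using d_next Suc.prems by blast
  then have "n = d w y" "w \<in> V" using Suc.hyps E_subset' by auto
  with Suc.hyps(1)[of w] Suc.prems obtain p where p: "p 0 = w" "p (d w y) = y"
    "\<forall>i\<le>d w y. p i \<in> V \<and> d (p i) y = d w y - i" "\<forall>i<d w y. (p i, p (Suc i)) \<in> E"
    by blast
  show ?case
    by (rule exI[of _ "\<lambda>i. case i of 0 \<Rightarrow> x | Suc j \<Rightarrow> p j"])
      (use p w Suc.prems in \<open>auto split: nat.splits\<close>)
qed

text \<open>A walk that never turns back and first moves away from \<open>z\<close> keeps doing so:
  at every later vertex the preceding one is nearer to \<open>z\<close>, hence by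
  \<open>branch\<close> the next one is farther.\<close>

lemma moving_away:
  assumes "\<And>i. i < n \<Longrightarrow> (p i, p (Suc i)) \<in> E"
    and "\<And>i. Suc i < n \<Longrightarrow> p i \<noteq> p (Suc (Suc i))"
    and "z \<in> V" "d (p (Suc 0)) z = Suc (d (p 0) z)"
    and "j \<le> n"
  shows "d (p j) z = d (p 0) z + j"
  using \<open>j \<le> n\<close>
proof (induction j rule: less_induct)
  case (less j)
  consider "j = 0" | "j = 1" | i where "j = Suc (Suc i)"
    by (metis One_nat_def not0_implies_Suc)
  then show ?case
  proof cases
    case 3
    have "(p (Suc i), p i) \<in> E" "(p (Suc i), p (Suc (Suc i))) \<in> E" "p i \<noteq> p (Suc (Suc i))"
      using assms(1)[of i] assms(1)[of "Suc i"] assms(2)[of i] less.prems 3 E_sym by auto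
    then show ?thesis
      using branch[of "p (Suc i)" "p i" "p j" z] less.IH[of i] less.IH[of "Suc i"] less.prems 3
        assms(3) by auto
  qed (use assms in auto)
qed

text \<open>From an inner vertex \<open>p i\<close>, at least one direction along the path leads
  away from a given \<open>z\<close>. Following it to its end adds \<open>diam - i\<close> or
  \<open>i\<close> to the distance from \<open>z\<close>, and the total is at most
  \<open>diam\<close>.\<close>

lemma diametral_path:
  obtains p where "\<And>i. i \<le> diam \<Longrightarrow> p i \<in> V" "inj_on p {..diam}"
    "\<And>i. i < diam \<Longrightarrow> (p i, p (Suc i)) \<in> E"
    "\<And>i. i \<le> diam \<Longrightarrow> ecc (p i) \<le> max i (diam - i)"
proof -
  have "diam \<in> ecc ` V"
    unfolding diam_def using finite_V V_nonempty by (intro Max_in) auto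
  then obtain x where x: "x \<in> V" "diam = ecc x" by blast
  obtain y where y: "y \<in> V" "d x y = ecc x" using ecc_attained by blast
  obtain p where p: "p 0 = x" "p diam = y" and
    pV: "\<And>i. i \<le> diam \<Longrightarrow> p i \<in> V" and py: "\<And>i. i \<le> diam \<Longrightarrow> d (p i) y = diam - i" and
    pE: "\<And>i. i < diam \<Longrightarrow> (p i, p (Suc i)) \<in> E"
    using geodesic[OF x(1) y(1)] x(2) y(2) by metis
  have inj: "inj_on p {..diam}"
    by (rule inj_onI) (metis py atMost_iff diff_diff_cancel)
  have "ecc (p i) \<le> max i (diam - i)" if i: "i \<le> diam" for i
  \<comment> \<open>At the two ends the claimed bound is \<open>diam\<close> itself;
    \<open>branch\<close> needs two neighbours on the path.\<close>
  proof (cases "i = 0 \<or> i = diam")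
    case True
    then show ?thesis using ecc_le_diam[OF pV[OF i]] i by auto
  next
    case False
    then have i: "0 < i" "i < diam" using i by auto
    show ?thesis
    proof (rule ecc_le)
      fix z assume z: "z \<in> V"
      have prev: "(p i, p (i - 1)) \<in> E" using pE[of "i - 1"] i E_sym by auto
      have "p (Suc i) \<noteq> p (i - 1)"
        using inj_onD[OF inj, of "Suc i" "i - 1"] i by fastforce
      then consider "d (p (Suc i)) z = Suc (d (p i) z)" | "d (p (i - 1)) z = Suc (d (p i) z)"
        using branch[OF pE[OF i(2)] prev _ z] by auto
      then show "d (p i) z \<le> max i (diam - i)"
      proof cases
        case 1
        have "d (p (i + (diam - i))) z = d (p (i + 0)) z + (diam - i)"
          by (rule moving_away[where n = "diam - i"])
            (use i 1 z pE in \<open>auto dest: inj_onD[OF inj]\<close>)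
        then show ?thesis using d_le_diam[OF y(1) z] i p by auto
      next
        case 2
        \<comment> \<open>The path is followed backwards, with \<open>p (i - j)\<close> as the
          vertex after \<open>j\<close> steps.\<close>
        have "d (p (i - i)) z = d (p (i - 0)) z + i"
        proof (rule moving_away[where n = i])
          show "(p (i - j), p (i - Suc j)) \<in> E" if "j < i" for j
            using pE[of "i - Suc j"] that i E_sym by (simp add: Suc_diff_Suc)
          show "p (i - j) \<noteq> p (i - Suc (Suc j))" if "Suc j < i" for j
            using inj_onD[OF inj, of "i - j" "i - Suc (Suc j)"] that i by fastforce
        qed (use 2 z in auto)
        then show ?thesis using d_le_diam[OF x(1) z] i p by auto
      qed
    qed
  qed
  then show ?thesis using that pV inj pE by blast
qed

section \<open>Internal vertices compared with the positions on a spine\<close>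

lemma finite_internal: "finite internal"
  using finite_V by (simp add: internal_def)

text \<open>Of two neighbours of \<open>v\<close>, one has eccentricity \<open>ecc v + 1\<close>,
  which cannot exceed \<open>diam\<close>.\<close>

lemma ecc_internal:
  assumes "v \<in> internal" shows "ecc v < diam"
proof -
  obtain x where x: "x \<in> V" "d v x = ecc v" using ecc_attained by blast
  have "\<not> card (E `` {v}) \<le> Suc 0"
    using assms by (simp add: internal_def deg_def)
  then obtain w w' where w: "(v, w) \<in> E" "(v, w') \<in> E" "w \<noteq> w'"
    using card_le_Suc0_iff_eq[OF finite_nbrs, of v] by blast
  then show ?thesis
    using ecc_branch[OF w] ecc_le_diam[of w] ecc_le_diam[of w'] E_subset' by fastforce
qed

lemma internal_path:
  assumes "\<And>i. i < diam \<Longrightarrow> (p i, p (Suc i)) \<in> E" "inj_on p {..diam}" "0 < i" "i < diam"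
  shows "p i \<in> internal"
proof -
  have e: "(p i, p (i - 1)) \<in> E" "(p i, p (Suc i)) \<in> E"
    using assms(1)[of "i - 1"] assms(1)[of i] assms(3,4) E_sym by auto
  have "p (i - 1) \<noteq> p (Suc i)"
    using inj_onD[OF assms(2), of "i - 1" "Suc i"] assms(3,4) by fastforce
  then have "card {p (i - 1), p (Suc i)} = 2" by simp
  moreover have "card {p (i - 1), p (Suc i)} \<le> deg (p i)"
    unfolding deg_def using e finite_nbrs by (intro card_mono) auto
  ultimately show ?thesis using e E_subset by (auto simp: internal_def)
qed

lemma diam_le_card_internal: "diam \<le> card internal + 1"
proof -
  obtain p where p: "inj_on p {..diam}" "\<And>i. i < diam \<Longrightarrow> (p i, p (Suc i)) \<in> E"
    using diametral_path by metis
  have "p ` {0<..<diam} \<subseteq> internal" using internal_path p by auto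
  then have "card (p ` {0<..<diam}) \<le> card internal" by (rule card_mono[OF finite_internal])
  moreover have "card (p ` {0<..<diam}) = diam - 1"
    by (subst card_image) (auto intro: inj_on_subset[OF p(1)])
  ultimately show ?thesis by simp
qed

text \<open>This supplies the cardinality hypothesis of \<open>sum_antitone_rearrangement\<close>.
  If \<open>t\<close> is at least \<open>diam - 1\<close>, all internal vertices count; otherwise
  the middle part of a diametral path already provides enough vertices of eccentricity at most
  \<open>t\<close>.\<close>

lemma card_path_ecc_le:
  "card {i. i < card internal \<and> max (Suc i) (card internal - i) \<le> t} \<le>
    card {v \<in> internal. ecc v \<le> t}"
proof (cases "diam \<le> Suc t")
  case True
  then have "{v \<in> internal. ecc v \<le> t} = internal" using ecc_internal by fastforce
  moreover have "card {i. i < card internal \<and> max (Suc i) (card internal - i) \<le> t} \<le>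
      card {..<card internal}"
    by (intro card_mono) auto
  ultimately show ?thesis by simp
next
  case False
  define k where "k = card internal"
  have k: "diam \<le> k + 1" using diam_le_card_internal by (simp add: k_def)
  obtain p where p: "inj_on p {..diam}" "\<And>i. i < diam \<Longrightarrow> (p i, p (Suc i)) \<in> E"
    "\<And>i. i \<le> diam \<Longrightarrow> ecc (p i) \<le> max i (diam - i)"
    using diametral_path by metis
  have "{i. i < k \<and> max (Suc i) (k - i) \<le> t} \<subseteq> {k - t..<t}" by auto
  then have "card {i. i < k \<and> max (Suc i) (k - i) \<le> t} \<le> card {k - t..<t}"
    by (intro card_mono) auto
  \<comment> \<open>The two sizes are \<open>2 * t - k\<close> and \<open>2 * t + 1 - diam\<close>,
    compared by \<open>diam \<le> k + 1\<close>.\<close>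
  also have "\<dots> \<le> Suc t - (diam - t)" using k False by simp
  also have "\<dots> = card {diam - t..t}" by simp
  also have "\<dots> = card (p ` {diam - t..t})"
    using False by (intro card_image[symmetric] inj_on_subset[OF p(1)]) auto
  also have "\<dots> \<le> card {v \<in> internal. ecc v \<le> t}"
  proof (rule card_mono)
    show "p ` {diam - t..t} \<subseteq> {v \<in> internal. ecc v \<le> t}"
    proof (rule image_subsetI)
      fix i assume "i \<in> {diam - t..t}"
      then have "i \<le> t" "diam - i \<le> t" "0 < i" "i < diam" using False by auto
      then show "p i \<in> {v \<in> internal. ecc v \<le> t}"
        using internal_path[of p i] p(1,2) p(3)[of i] by auto
    qed
  qed (simp add: finite_internal)
  finally show ?thesis by (simp add: k_def)
qed


section \<open>Lower bound for the index\<close>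

lemma ecc_pos: assumes "2 \<le> card V" "v \<in> V" shows "0 < ecc v"
proof -
  have "V \<noteq> {v}" using assms(1) by auto
  then obtain x where "x \<in> V" "x \<noteq> v" using V_nonempty by auto
  then show ?thesis using d_pos[of v x] d_le_ecc[of x v] assms(2) by auto
qed

lemma deg_pos: assumes "2 \<le> card V" "v \<in> V" shows "0 < deg v"
proof -
  have "V \<noteq> {v}" using assms(1) by auto
  then obtain x where "x \<in> V" "v \<noteq> x" using V_nonempty by auto
  then have "E `` {v} \<noteq> {}" using d_next[of v x] assms(2) by auto
  then show ?thesis using finite_nbrs by (simp add: deg_def card_gt_0_iff)
qed

text \<open>Replacing the number of children by \<open>deg v - 1\<close> leaves something over at
  the center. If the center is an edge, its two arcs of equal eccentricity are left; if it is a
  single vertex, that vertex has one child more than the bound counts.\<close>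

lemma index_ge_center:
  assumes "2 \<le> card V"
  shows "(\<Sum>v\<in>V. real (deg v - 1) * (1 / ecc v + 1 / Suc (ecc v))) +
      (1 / real ((diam + 1) div 2) + 1 / real (diam div 2 + 1)) \<le> (\<Sum>v\<in>V. real (deg v) / ecc v)"
    (is "?S + ?h \<le> _")
proof -
  let ?g = "\<lambda>v. 1 / real (ecc v) + 1 / real (Suc (ecc v))"
  define L where "L = {(v, w)\<in>E. ecc v = ecc w}"
  have finL: "finite L" using finite_E by (auto simp: L_def elim: finite_subset[rotated])
  obtain c where c: "c \<in> V" "\<And>v. v \<in> V \<Longrightarrow> ecc c \<le> ecc v"
    using arg_min_if_finite[OF finite_V V_nonempty, of ecc] by (metis not_le_imp_less)
  obtain p where pV: "\<And>i. i \<le> diam \<Longrightarrow> p i \<in> V" and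
    pE: "\<And>i. i < diam \<Longrightarrow> (p i, p (Suc i)) \<in> E" and
    p_ecc: "\<And>i. i \<le> diam \<Longrightarrow> ecc (p i) \<le> max i (diam - i)"
    using diametral_path by metis
  \<comment> \<open>The midpoint of a diametral path has eccentricity at most \<open>diam\<close>
    halved and rounded up.\<close>
  have r: "ecc c \<le> (diam + 1) div 2"
    using c(2)[OF pV, of "diam div 2"] p_ecc[of "diam div 2"] by auto
  have r_pos: "0 < ecc c" using ecc_pos assms c by blast
  have children_ge: "?S \<le> (\<Sum>v\<in>V. card (children v) * ?g v)"
    using deg_le_card_children by (intro sum_mono mult_right_mono) (auto simp del: of_nat_Suc)
  show ?thesis
  proof (cases "\<exists>a b. (a, b) \<in> E \<and> ecc a = ecc c \<and> ecc b = ecc c")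
    case True
    then obtain a b where ab: "(a, b) \<in> E" "ecc a = ecc c" "ecc b = ecc c" by blast
    then have "a \<noteq> b" using E_irrefl by auto
    \<comment> \<open>The central edge gives two arcs, hence twice \<open>1 / ecc c\<close>.\<close>
    have "{(a, b), (b, a)} \<subseteq> L" using ab E_sym by (auto simp: L_def)
    then have "(\<Sum>(v, w)\<in>{(a, b), (b, a)}. 1 / real (ecc v)) \<le> (\<Sum>(v, w)\<in>L. 1 / real (ecc v))"
      using finL by (intro sum_mono2) auto
    then have "1 / real (ecc c) + 1 / real (ecc c) \<le> (\<Sum>(v, w)\<in>L. 1 / real (ecc v))"
      using \<open>a \<noteq> b\<close> ab by simp
    moreover have "?h \<le> 1 / real (ecc c) + 1 / real (ecc c)"
      using r r_pos by (intro add_mono divide_left_mono) auto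
    ultimately show ?thesis using children_ge index_eq by (simp add: L_def)
  next
    case False
    \<comment> \<open>Otherwise \<open>diam\<close> would be odd and the two middle vertices of the
      diametral path, which are adjacent, would both have the minimal eccentricity.\<close>
    have r': "ecc c \<le> diam div 2"
    proof (rule ccontr)
      let ?m = "diam div 2"
      assume "\<not> ecc c \<le> ?m"
      then have odd: "diam - ?m = Suc ?m" "diam - Suc ?m = ?m" "?m < diam" "ecc c = Suc ?m"
        using r by presburger+
      have "ecc (p ?m) = ecc c"
        using p_ecc[of ?m] c(2)[OF pV, of ?m] odd by auto
      moreover have "ecc (p (Suc ?m)) = ecc c"
        using p_ecc[of "Suc ?m"] c(2)[OF pV, of "Suc ?m"] odd by auto
      ultimately show False using False pE[of ?m] odd(3) by blast
    qed
    \<comment> \<open>All neighbours of the only center are children, so \<open>c\<close> has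
      \<open>deg c\<close> of them instead of \<open>deg c - 1\<close>; the surplus is one copy of
      \<open>?g c\<close>.\<close>
    have "ecc w = Suc (ecc c)" if "(c, w) \<in> E" for w
      using ecc_step[OF that] c(2)[of w] E_subset'[OF that] False that by (metis le_SucE le_antisym)
    then have "children c = E `` {c}" by (auto simp: children_def)
    then have card_c: "real (card (children c)) = real (deg c - 1) + 1"
      using deg_pos[OF assms c(1)] by (simp add: deg_def)
    have "?S + ?g c = real (card (children c)) * ?g c + (\<Sum>v\<in>V - {c}. real (deg v - 1) * ?g v)"
      unfolding sum.remove[OF finite_V c(1)] card_c distrib_right by simp
    also have "\<dots> \<le> real (card (children c)) * ?g c + (\<Sum>v\<in>V - {c}. real (card (children v)) * ?g v)"
      using deg_le_card_children
      by (intro add_left_mono sum_mono mult_right_mono) (auto simp del: of_nat_Suc)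
    also have "\<dots> = (\<Sum>v\<in>V. card (children v) * ?g v)"
      by (rule sum.remove[OF finite_V c(1), symmetric])
    also have "\<dots> \<le> (\<Sum>v\<in>V. real (deg v) / ecc v)"
      unfolding index_eq by (simp add: sum_nonneg split_beta)
    finally have "?S + ?g c \<le> (\<Sum>v\<in>V. real (deg v) / ecc v)" .
    moreover have "?h \<le> ?g c"
      using r r' r_pos by (intro add_mono divide_left_mono) auto
    ultimately show ?thesis by linarith
  qed
qed

text \<open>Here \<open>\<pi>\<close> assigns the internal vertices to spine positions so that
  larger degrees sit where \<open>e\<close> is larger. Rearrangement then replaces the actual
  eccentricities by \<open>e\<close>, and the central term is taken at the extreme diameter
  \<open>k + 1\<close>.\<close>

lemma index_lower_bound:
  fixes \<pi> :: "nat \<Rightarrow> 'a" and k :: nat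
  defines "e \<equiv> \<lambda>i. max (Suc i) (k - i)"
  assumes card: "2 \<le> card V"
    and bij: "bij_betw \<pi> {..<k} internal"
    and mono: "\<And>i j. i < k \<Longrightarrow> j < k \<Longrightarrow> e i < e j \<Longrightarrow> deg (\<pi> i) \<le> deg (\<pi> j)"
  shows "(\<Sum>i<k. real (deg (\<pi> i) - 1) * (1 / e i + 1 / Suc (e i))) +
      (1 / real ((k + 2) div 2) + 1 / real ((k + 1) div 2 + 1)) \<le> (\<Sum>v\<in>V. real (deg v) / ecc v)"
proof -
  have k: "card internal = k" using bij_betw_same_card[OF bij] by simp
  have "(\<Sum>i<k. real (deg (\<pi> i) - 1) * (1 / e i + 1 / Suc (e i))) \<le>
      (\<Sum>i<k. real (deg (\<pi> i) - 1) * (1 / ecc (\<pi> i) + 1 / Suc (ecc (\<pi> i))))"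
  proof (rule sum_antitone_rearrangement[where m = 1 and g = "\<lambda>s. 1 / real s + 1 / real (Suc s)"])
    fix t
    have "bij_betw \<pi> {i \<in> {..<k}. ecc (\<pi> i) \<le> t} {v \<in> internal. ecc v \<le> t}"
      using bij by (auto simp: bij_betw_def inj_on_def)
    then show "card {i \<in> {..<k}. e i \<le> t} \<le> card {i \<in> {..<k}. ecc (\<pi> i) \<le> t}"
      using card_path_ecc_le[of t] bij_betw_same_card by (fastforce simp: k e_def)
  next
    fix i assume "i \<in> {..<k}"
    then have "\<pi> i \<in> V" using bij by (auto simp: bij_betw_def internal_def)
    then show "1 \<le> ecc (\<pi> i)" using ecc_pos[OF card] by fastforce
  next
    fix s :: nat assume "1 \<le> s"
    then show "1 / real (Suc s) + 1 / real (Suc (Suc s)) \<le> 1 / real s + 1 / real (Suc s)"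
      by (intro add_mono divide_left_mono) auto
  next
    fix i j assume "i \<in> {..<k}" "j \<in> {..<k}" "e i < e j"
    then show "real (deg (\<pi> i) - 1) \<le> real (deg (\<pi> j) - 1)"
      using mono[of i j] by auto
  qed (auto simp: e_def)
  also have "\<dots> = (\<Sum>v\<in>internal. real (deg v - 1) * (1 / ecc v + 1 / Suc (ecc v)))"
    by (rule sum.reindex_bij_betw[OF bij])
  also have "\<dots> = (\<Sum>v\<in>V. real (deg v - 1) * (1 / ecc v + 1 / Suc (ecc v)))"
    using finite_V by (intro sum.mono_neutral_left) (auto simp: internal_def)
  finally have "(\<Sum>i<k. real (deg (\<pi> i) - 1) * (1 / e i + 1 / Suc (e i))) \<le>
      (\<Sum>v\<in>V. real (deg v - 1) * (1 / ecc v + 1 / Suc (ecc v)))" .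
  moreover have "1 / real ((k + 2) div 2) + 1 / real ((k + 1) div 2 + 1) \<le>
      1 / real ((diam + 1) div 2) + 1 / real (diam div 2 + 1)"
  proof -
    obtain v where "v \<in> V" using V_nonempty by blast
    \<comment> \<open>With \<open>diam = 0\<close> a denominator would vanish and, since
      \<open>1 / 0 = 0\<close>, monotonicity would fail.\<close>
    then have "0 < diam" using ecc_pos[OF card] ecc_le_diam by fastforce
    moreover have "(diam + 1) div 2 \<le> (k + 2) div 2" "diam div 2 \<le> (k + 1) div 2"
      using diam_le_card_internal k by (auto intro: div_le_mono)
    ultimately show ?thesis by (intro add_mono divide_left_mono) auto
  qed
  ultimately show ?thesis using index_ge_center[OF card] by linarith
qed

end

section \<open>Walk distance\<close>

text \<open>A natural number in place of the extended real \<open>\<mu>\<close> behind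
  \<open>distance\<close>, suited to induction. The value is meaningful only if some walk joins the
  two vertices.\<close>

definition walk_dist :: "'a pair_pre_digraph \<Rightarrow> 'a \<Rightarrow> 'a \<Rightarrow> nat" where
  "walk_dist G u v = (LEAST n. \<exists>p. pre_digraph.awalk (with_proj G) u p v \<and> length p = n)"

lemma (in pair_wf_digraph) walk_dist_le: "awalk u p v \<Longrightarrow> walk_dist G u v \<le> length p"
  unfolding walk_dist_def by (rule Least_le) auto

lemma (in pair_wf_digraph) walk_dist_attained:
  assumes "awalk u p v"
  obtains q where "awalk u q v" "length q = walk_dist G u v"
proof -
  have "\<exists>q. awalk u q v \<and> length q = walk_dist G u v"
    unfolding walk_dist_def by (rule LeastI_ex) (use assms in blast)
  then show ?thesis using that by blast
qed

lemma (in pair_wf_digraph) distance_eq_walk_dist: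
  assumes "awalk u p v"
  shows "distance G u v = real (walk_dist G u v)"
proof -
  have cost: "awalk_cost (\<lambda>_. 1) q = real (length q)" for q :: "('a \<times> 'a) list"
    by (induction q) auto
  obtain q where q: "awalk u q v" "length q = walk_dist G u v"
    using walk_dist_attained[OF assms] .
  have "\<mu> (\<lambda>_. 1) u v = ereal (real (walk_dist G u v))"
    unfolding \<mu>_def
  proof (rule INF_eqI)
    fix r assume "r \<in> {p. awalk u p v}"
    then show "ereal (real (walk_dist G u v)) \<le> ereal (awalk_cost (\<lambda>_. 1) r)"
      using walk_dist_le by (auto simp: cost)
  next
    fix y assume "\<And>r. r \<in> {p. awalk u p v} \<Longrightarrow> y \<le> ereal (awalk_cost (\<lambda>_. 1) r)"
    from this[of q] show "y \<le> ereal (real (walk_dist G u v))" using q by (simp add: cost)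
  qed
  then show ?thesis by (simp add: distance_def)
qed

lemma (in pair_graph) connected_obtain_awalk:
  assumes "connected (with_proj G)" "u \<in> pverts G" "v \<in> pverts G"
  obtains p where "awalk u p v"
proof -
  have "strongly_connected (with_proj G)"
    using symmetric_connected_imp_strongly_connected[OF pair_sym_arcs assms(1)] .
  then have "u \<rightarrow>\<^sup>*\<^bsub>with_proj G\<^esub> v"
    using assms(2,3) unfolding strongly_connected_def by simp
  then show ?thesis using that by (auto simp: reachable_awalk)
qed

lemma length_rev_path [simp]: "length (rev_path p) = length p"
  by (induction p) auto

text \<open>If a shortest walk from \<open>w\<close> to \<open>x\<close> met \<open>v\<close>, its
  remainder from \<open>v\<close> would be strictly shorter than \<open>walk_dist G w x\<close>, as
  the part before \<open>v\<close> is nonempty.\<close>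

lemma (in pair_wf_digraph) awalk_avoiding:
  assumes "awalk w p x" "w \<noteq> v" "walk_dist G w x \<le> walk_dist G v x"
  obtains q where "awalk w q x" "v \<notin> set (awalk_verts w q)"
proof -
  obtain q where q: "awalk w q x" "length q = walk_dist G w x"
    using walk_dist_attained[OF assms(1)] .
  have "v \<notin> set (awalk_verts w q)"
  proof
    assume "v \<in> set (awalk_verts w q)"
    then obtain r s where rs: "q = r @ s" "awalk w r v" "awalk v s x"
      using awalk_decomp[OF q(1)] by blast
    then have "r \<noteq> []" using assms(2) by (auto simp: awalk_Nil_iff)
    then show False using walk_dist_le[OF rs(3)] rs(1) q(2) assms(3) by (cases r) auto
  qed
  then show ?thesis using that q by blast
qed

text \<open>Shorten the walk to a path, which uses only arcs of the walk and so still avoids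
  \<open>v\<close>, and close it through \<open>v\<close>. Since \<open>w\<close> and
  \<open>w'\<close> differ, the path has an arc and the cycle has length at least three.\<close>

lemma (in pair_graph) cycle_of_avoiding_walk:
  assumes "(v, w) \<in> parcs G" "(v, w') \<in> parcs G" "w \<noteq> w'"
    and p: "awalk w p w'" "v \<notin> set (awalk_verts w p)"
  obtains c where "cycle c" "3 \<le> length c"
proof -
  define q where "q = awalk_to_apath p"
  have q: "apath w q w'" "set q \<subseteq> set p"
    using apath_awalk_to_apath[OF p(1)] awalk_to_apath_subset[OF p(1)] by (simp_all add: q_def)
  then have walk: "awalk w q w'" by (simp add: apath_def)
  have v: "v \<notin> set (awalk_verts w q)"
    using q(2) p(2) by (auto simp: set_awalk_verts[OF walk] set_awalk_verts[OF p(1)])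
  have "q \<noteq> []" using walk assms(3) by (auto simp: awalk_Nil_iff)
  have last: "awalk w' [(w', v)] v"
    using arcs_symmetric[OF assms(2)] by (auto simp: awalk_simps in_arcsD1[OF assms(1)])
  then have walk': "awalk w (q @ [(w', v)]) v" using walk awalk_appendI by blast
  then have "awalk_verts w (q @ [(w', v)]) = awalk_verts w q @ [v]"
    using walk by (simp add: awalk_verts_append)
  then have "cycle ((v, w) # q @ [(w', v)])"
    unfolding cycle_def using walk' assms(1) q(1) v
    by (intro exI[of _ v]) (auto simp: awalk_Cons_iff apath_def simp del: awalk_append_iff)
  moreover have "3 \<le> length ((v, w) # q @ [(w', v)])" using \<open>q \<noteq> []\<close> by (cases q) auto
  ultimately show ?thesis using that by blast
qed

lemma sym_tree_tree_distance:
  assumes "sym_tree G"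
  shows "tree_distance (pverts G) (parcs G) (walk_dist G)"
proof -
  interpret pair_graph G using assms by (simp add: sym_tree_def)
  have conn: "connected (with_proj G)" using assms by (simp add: sym_tree_def)
  have no_cycle: "\<not> (cycle c \<and> 3 \<le> length c)" for c
    using assms by (simp add: sym_tree_def)
  note walkE = connected_obtain_awalk[OF conn]
  show ?thesis
  proof
    show "finite (pverts G)" by (rule pair_finite_verts)
    show "pverts G \<noteq> {}" using conn by (auto simp: connected_def strongly_connected_def)
    show "u \<in> pverts G" if "(u, v) \<in> parcs G" for u v using that by (rule in_arcsD1)
    show "(v, u) \<in> parcs G" if "(u, v) \<in> parcs G" for u v using that by (rule arcs_symmetric)
    show "(u, u) \<notin> parcs G" for u using no_loops' by blast
    show "walk_dist G u u = 0" if "u \<in> pverts G" for u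
      using walk_dist_le[of u "[]" u] that by (simp add: awalk_Nil_iff)
    have le: "walk_dist G u v \<le> walk_dist G v u" if uv: "u \<in> pverts G" "v \<in> pverts G" for u v
    proof -
      obtain p where "awalk v p u" using walkE[OF uv(2,1)] .
      then obtain q where "awalk v q u" "length q = walk_dist G v u" by (rule walk_dist_attained)
      then show ?thesis using walk_dist_le[of u "rev_path q" v] by simp
    qed
    show "walk_dist G u v = walk_dist G v u" if "u \<in> pverts G" "v \<in> pverts G" for u v
      using le that by (simp add: le_antisym)
    show step: "walk_dist G w x \<le> Suc (walk_dist G v x)" if vw: "(v, w) \<in> parcs G" "x \<in> pverts G" for v w x
    proof -
      obtain p where "awalk v p x" using walkE[OF in_arcsD1[OF vw(1)] vw(2)] .
      then obtain q where "awalk v q x" "length q = walk_dist G v x" by (rule walk_dist_attained)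
      then show ?thesis
        using walk_dist_le[of w "(w, v) # q" x] arcs_symmetric[OF vw(1)]
        by (simp add: awalk_Cons_iff)
    qed
    show "\<exists>w. (u, w) \<in> parcs G \<and> walk_dist G u x = Suc (walk_dist G w x)"
      if ux: "u \<in> pverts G" "x \<in> pverts G" "u \<noteq> x" for u x
    proof -
      obtain p where "awalk u p x" using walkE[OF ux(1,2)] .
      then obtain q where q: "awalk u q x" "length q = walk_dist G u x" by (rule walk_dist_attained)
      then obtain w r where r: "q = (u, w) # r" "(u, w) \<in> parcs G" "awalk w r x"
        using ux(3) by (cases q) (auto simp: awalk_simps)
      obtain s where s: "awalk w s x" "length s = walk_dist G w x"
        using walk_dist_attained[OF r(3)] .
      have "walk_dist G u x \<le> Suc (length s)"
        using walk_dist_le[of u "(u, w) # s" x] s r by (simp add: awalk_Cons_iff)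
      then show ?thesis using walk_dist_le[OF r(3)] q(2) r s(2) by auto
    qed
    \<comment> \<open>If neither neighbour were farther from \<open>x\<close> than \<open>v\<close>,
      shortest walks from both to \<open>x\<close> would avoid \<open>v\<close>; joined at
      \<open>x\<close>, they form a walk from \<open>w\<close> to \<open>w'\<close> that closes to a
      cycle through \<open>v\<close>.\<close>
    show "walk_dist G w x = Suc (walk_dist G v x) \<or> walk_dist G w' x = Suc (walk_dist G v x)"
      if vw: "(v, w) \<in> parcs G" "(v, w') \<in> parcs G" "w \<noteq> w'" "x \<in> pverts G" for v w w' x
    proof (rule ccontr)
      assume *: "\<not> ?thesis"
      have V: "v \<in> pverts G" "w \<in> pverts G" "w' \<in> pverts G"
        using vw in_arcsD1 in_arcsD2 by blast+
      have near: "walk_dist G w x \<le> walk_dist G v x" "walk_dist G w' x \<le> walk_dist G v x"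
        using step[OF vw(1,4)] step[OF vw(2,4)] * by auto
      have ne: "w \<noteq> v" "w' \<noteq> v" using no_loops' vw by blast+
      obtain p where p: "awalk w p x" "v \<notin> set (awalk_verts w p)"
        using walkE[OF V(2) vw(4)] awalk_avoiding[OF _ ne(1) near(1)] by metis
      obtain q where q: "awalk w' q x" "v \<notin> set (awalk_verts w' q)"
        using walkE[OF V(3) vw(4)] awalk_avoiding[OF _ ne(2) near(2)] by metis
      have q': "awalk x (rev_path q) w'" using q by simp
      then have "awalk w (p @ rev_path q) w'" using p awalk_appendI by blast
      moreover have "v \<notin> set (awalk_verts w (p @ rev_path q))"
        using p q by (simp only: set_awalk_verts_append[OF p(1) q'] awalk_verts_rev_path[OF q(1)]) simp
      ultimately show False
        using cycle_of_avoiding_walk[OF vw(1,2,3)] no_cycle by blast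
    qed
  qed
qed

section \<open>The index of a symmetric tree in terms of walk distance\<close>

lemma degree_eq_card_nbrs: "degree G u = card (parcs G `` {u})"
proof -
  have "snd ` out_arcs (with_proj G) u = parcs G `` {u}"
    by (force simp: out_arcs_def)
  moreover have "inj_on snd (out_arcs (with_proj G) u)"
    by (auto simp: inj_on_def out_arcs_def)
  ultimately show ?thesis
    unfolding degree_def out_degree_def by (metis card_image)
qed

lemma sym_tree_distance:
  assumes "sym_tree G" "u \<in> pverts G" "v \<in> pverts G"
  shows "distance G u v = real (walk_dist G u v)"
proof -
  interpret pair_graph G using assms by (simp add: sym_tree_def)
  obtain p where "awalk u p v"
    using connected_obtain_awalk assms by (auto simp: sym_tree_def)
  then show ?thesis by (rule distance_eq_walk_dist)
qed

lemma sym_tree_eccentricity: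
  assumes "sym_tree G" "u \<in> pverts G"
  shows "eccentricity G u = real (tree_distance.ecc (pverts G) (walk_dist G) u)"
proof -
  interpret tree_distance "pverts G" "parcs G" "walk_dist G"
    using assms(1) by (rule sym_tree_tree_distance)
  have "distance G u ` pverts G = real ` walk_dist G u ` pverts G"
    using sym_tree_distance[OF assms] by (simp add: image_image)
  moreover have "Max (real ` walk_dist G u ` pverts G) = real (ecc u)"
    unfolding ecc_def using finite_V V_nonempty
    by (intro mono_Max_commute[symmetric]) (auto simp: mono_def)
  ultimately show ?thesis by (simp add: eccentricity_def)
qed

lemma sym_tree_index:
  assumes "sym_tree G"
  shows "connective_eccentricity_index G =
    (\<Sum>u\<in>pverts G. real (tree_distance.deg (parcs G) u) /
       tree_distance.ecc (pverts G) (walk_dist G) u)"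
proof -
  interpret tree_distance "pverts G" "parcs G" "walk_dist G"
    using assms by (rule sym_tree_tree_distance)
  show ?thesis
    unfolding connective_eccentricity_index_def
    using sym_tree_eccentricity[OF assms] by (simp add: deg_def degree_eq_card_nbrs)
qed

text \<open>A vertex of maximal rank on a cycle would have two neighbours of smaller or equal rank.\<close>

lemma (in pair_graph) no_long_cycle_if_rank:
  fixes rank :: "'a \<Rightarrow> nat"
  assumes "\<And>v w w'. (v, w) \<in> parcs G \<Longrightarrow> (v, w') \<in> parcs G \<Longrightarrow>
      rank w \<le> rank v \<Longrightarrow> rank w' \<le> rank v \<Longrightarrow> w = w'"
    and "cycle c"
  shows "length c < 3"
proof (rule ccontr)
  assume "\<not> length c < 3"
  define n where "n = length c"
  then have n: "3 \<le> n" using \<open>\<not> length c < 3\<close> by simp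
  obtain u where u: "awalk u c u" "distinct (tl (awalk_verts u c))"
    using \<open>cycle c\<close> by (auto simp: cycle_def)
  have cas: "pcas u c u" using u(1) by (auto simp: awalk_def)
  have next_arc: "fst (q ! Suc i) = snd (q ! i)" if "pcas x q y" "Suc i < length q" for x y q i
    using that
  proof (induction q arbitrary: x i)
    case (Cons a q)
    then show ?case by (cases i; cases q) auto
  qed simp
  have "snd (last q) = y \<and> fst (hd q) = x" if "pcas x q y" "q \<noteq> []" for x y q
    using that by (induction q arbitrary: x) (auto split: if_splits)
  from this[OF cas] n have wrap: "fst (c ! 0) = snd (c ! (n - 1))"
    by (cases "c = []") (auto simp: n_def hd_conv_nth last_conv_nth)
  have dist: "distinct (map snd c)"
    using u(2) awalk_verts_conv'[OF cas] n by (auto simp: n_def split: if_splits)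
  \<comment> \<open>The heads of the arcs of the cycle, indexed cyclically.\<close>
  define a where "a j = snd (c ! (j mod n))" for j
  have a_inj: "i mod n = j mod n" if "a i = a j" for i j
    using that nth_eq_iff_index_eq[OF dist, of "i mod n" "j mod n"] n
    by (simp add: a_def n_def[symmetric])
  have arc: "(a j, a (Suc j)) \<in> parcs G" for j
  proof -
    have "Suc j mod n < length c" using n by (simp add: n_def[symmetric])
    then have "c ! (Suc j mod n) \<in> parcs G" using u(1) by (auto simp: awalk_def)
    moreover have "fst (c ! (Suc j mod n)) = a j"
    proof (cases "Suc (j mod n) = n")
      case True
      then have "j mod n = n - 1" by simp
      then show ?thesis using True wrap by (simp add: a_def mod_Suc)
    next
      case False
      then have "Suc (j mod n) < n" using mod_less_divisor[of n j] n by linarith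
      then show ?thesis
        using False next_arc[OF cas, of "j mod n"] by (simp add: a_def mod_Suc n_def)
    qed
    ultimately show ?thesis by (metis a_def prod.collapse)
  qed
  have "\<exists>i<n. \<forall>j<n. rank (a j) \<le> rank (a i)"
  proof -
    have "Max ((\<lambda>i. rank (a i)) ` {..<n}) \<in> (\<lambda>i. rank (a i)) ` {..<n}"
      using n by (intro Max_in) (auto simp: lessThan_empty_iff)
    then obtain i where "i < n" "rank (a i) = Max ((\<lambda>i. rank (a i)) ` {..<n})" by auto
    then show ?thesis by (intro exI[of _ i]) auto
  qed
  then obtain i where i: "i < n" "\<And>j. j < n \<Longrightarrow> rank (a j) \<le> rank (a i)" by blast
  have a_mod: "a (j mod n) = a j" for j by (simp add: a_def)
  have max: "rank (a j) \<le> rank (a (i + n))" for j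
    using i(2)[of "j mod n"] n by (simp add: a_mod a_def)
  \<comment> \<open>The index \<open>i + n\<close> stands for \<open>i\<close>, so that the
    predecessor also exists for \<open>i = 0\<close>.\<close>
  have "(a (i + n), a (i + n - 1)) \<in> parcs G"
    using arc[of "i + n - 1"] n arcs_symmetric by simp
  moreover have "(a (i + n), a (Suc (i + n))) \<in> parcs G" by (rule arc)
  ultimately have "a (i + n - 1) = a (Suc (i + n))" using assms(1) max by blast
  \<comment> \<open>Coinciding neighbours on the cycle force \<open>n\<close> to divide
    \<open>2\<close>.\<close>
  then have "Suc (i + n) mod n = (i + n - 1) mod n" by (metis a_inj)
  then have "n dvd Suc (i + n) - (i + n - 1)"
    using n by (subst mod_eq_dvd_iff_nat[symmetric]) auto
  moreover have "Suc (i + n) - (i + n - 1) = 2" using n by simp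
  ultimately show False using n by (auto dest: dvd_imp_le)
qed

section \<open>Caterpillars\<close>

text \<open>The sizes of the pendant sets are left open, so the bare path is the instance with all
  \<open>L z\<close> empty.\<close>

locale caterpillar =
  fixes zs :: "'a list" and L :: "'a \<Rightarrow> 'a set"
  assumes zs_nonempty: "zs \<noteq> []" and distinct_zs: "distinct zs"
    and finite_L: "z \<in> set zs \<Longrightarrow> finite (L z)"
    and L_disjoint_zs: "z \<in> set zs \<Longrightarrow> L z \<inter> set zs = {}"
    and L_disjoint: "u \<in> set zs \<Longrightarrow> v \<in> set zs \<Longrightarrow> u \<noteq> v \<Longrightarrow> L u \<inter> L v = {}"
begin

definition graph :: "'a pair_pre_digraph" where
  "graph = attach_pendants (path_graph zs) L"

definition neighbour_positions :: "nat \<Rightarrow> nat set" where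
  "neighbour_positions i = {j. j < length zs \<and> (j = Suc i \<or> i = Suc j)}"

text \<open>The projection to the spine: a leaf gets the index of the vertex it hangs from. It
  serves as a potential for \<open>potential_le_d\<close>.\<close>

definition position :: "'a \<Rightarrow> nat" where
  "position v = (THE i. i < length zs \<and> (v = zs ! i \<or> v \<in> L (zs ! i)))"

lemma pverts_graph: "pverts graph = set zs \<union> (\<Union>z\<in>set zs. L z)"
  by (simp add: graph_def attach_pendants_def path_graph_def)

lemma nth_in_pverts: "i < length zs \<Longrightarrow> zs ! i \<in> pverts graph"
  by (simp add: pverts_graph)

lemma leaf_in_pverts: "i < length zs \<Longrightarrow> x \<in> L (zs ! i) \<Longrightarrow> x \<in> pverts graph"
  by (auto simp: pverts_graph)

lemma pverts_cases:
  assumes "v \<in> pverts graph"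
  obtains (spine) i where "i < length zs" "v = zs ! i"
    | (leaf) i where "i < length zs" "v \<in> L (zs ! i)"
  using assms by (auto simp: pverts_graph in_set_conv_nth)

lemma leaf_not_spine: "i < length zs \<Longrightarrow> x \<in> L (zs ! i) \<Longrightarrow> j < length zs \<Longrightarrow> x \<noteq> zs ! j"
  using L_disjoint_zs[of "zs ! i"] by auto

lemma leaf_unique:
  "i < length zs \<Longrightarrow> x \<in> L (zs ! i) \<Longrightarrow> j < length zs \<Longrightarrow> x \<in> L (zs ! j) \<Longrightarrow> i = j"
  using L_disjoint[of "zs ! i" "zs ! j"] nth_eq_iff_index_eq[OF distinct_zs, of i j] by auto

lemma position_nth: "i < length zs \<Longrightarrow> position (zs ! i) = i"
  unfolding position_def
  by (rule the_equality) (auto simp: nth_eq_iff_index_eq[OF distinct_zs] dest: leaf_not_spine)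

lemma position_leaf: "i < length zs \<Longrightarrow> x \<in> L (zs ! i) \<Longrightarrow> position x = i"
  unfolding position_def
  by (rule the_equality) (auto dest: leaf_unique leaf_not_spine)

lemma arcs_iff:
  "(u, v) \<in> parcs graph \<longleftrightarrow>
    (\<exists>i<length zs. \<exists>j\<in>neighbour_positions i. u = zs ! i \<and> v = zs ! j) \<or>
    (\<exists>i<length zs. u = zs ! i \<and> v \<in> L (zs ! i)) \<or>
    (\<exists>i<length zs. v = zs ! i \<and> u \<in> L (zs ! i))"
proof -
  have path: "(\<exists>i. Suc i < length zs \<and> (u = zs ! i \<and> v = zs ! Suc i \<or> u = zs ! Suc i \<and> v = zs ! i)) \<longleftrightarrow>
      (\<exists>i<length zs. \<exists>j\<in>neighbour_positions i. u = zs ! i \<and> v = zs ! j)"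
    by (auto simp: neighbour_positions_def dest: Suc_lessD)
  have set_zs: "(\<exists>z\<in>set zs. P z) \<longleftrightarrow> (\<exists>i<length zs. P (zs ! i))" for P
    by (metis in_set_conv_nth)
  have "(u, v) \<in> parcs graph \<longleftrightarrow>
      (\<exists>i. Suc i < length zs \<and> (u = zs ! i \<and> v = zs ! Suc i \<or> u = zs ! Suc i \<and> v = zs ! i)) \<or>
      (\<exists>z\<in>set zs. u = z \<and> v \<in> L z) \<or> (\<exists>z\<in>set zs. v = z \<and> u \<in> L z)"
    by (auto simp: graph_def attach_pendants_def path_graph_def)
  then show ?thesis unfolding path set_zs .
qed

lemma arc_spine: "i < length zs \<Longrightarrow> j \<in> neighbour_positions i \<Longrightarrow> (zs ! i, zs ! j) \<in> parcs graph"
  and arc_to_leaf: "i < length zs \<Longrightarrow> x \<in> L (zs ! i) \<Longrightarrow> (zs ! i, x) \<in> parcs graph"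
  and arc_from_leaf: "i < length zs \<Longrightarrow> x \<in> L (zs ! i) \<Longrightarrow> (x, zs ! i) \<in> parcs graph"
  unfolding arcs_iff by blast+

lemma arc_cases:
  assumes "(u, v) \<in> parcs graph"
  obtains (spine) i j where "i < length zs" "j < length zs" "j \<in> neighbour_positions i"
      "u = zs ! i" "v = zs ! j"
    | (to_leaf) i where "i < length zs" "u = zs ! i" "v \<in> L (zs ! i)"
    | (from_leaf) i where "i < length zs" "v = zs ! i" "u \<in> L (zs ! i)"
  using assms unfolding arcs_iff neighbour_positions_def by blast

lemma nbrs_nth:
  assumes "i < length zs"
  shows "parcs graph `` {zs ! i} = (!) zs ` neighbour_positions i \<union> L (zs ! i)"
proof
  show "parcs graph `` {zs ! i} \<subseteq> (!) zs ` neighbour_positions i \<union> L (zs ! i)"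
  proof
    fix v assume "v \<in> parcs graph `` {zs ! i}"
    then have "(zs ! i, v) \<in> parcs graph" by simp
    then show "v \<in> (!) zs ` neighbour_positions i \<union> L (zs ! i)"
    proof (cases rule: arc_cases)
      case (from_leaf a)
      then show ?thesis using leaf_not_spine[OF from_leaf(1,3) assms] by simp
    qed (use assms nth_eq_iff_index_eq[OF distinct_zs] in auto)
  qed
qed (use arc_spine[OF assms] arc_to_leaf[OF assms] in auto)

lemma nbrs_leaf:
  assumes "i < length zs" "x \<in> L (zs ! i)"
  shows "parcs graph `` {x} = {zs ! i}"
proof
  show "parcs graph `` {x} \<subseteq> {zs ! i}"
  proof
    fix v assume "v \<in> parcs graph `` {x}"
    then have "(x, v) \<in> parcs graph" by simp
    then show "v \<in> {zs ! i}"
      by (cases rule: arc_cases) (use leaf_not_spine[OF assms] leaf_unique[OF assms] in blast)+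
  qed
qed (use arc_from_leaf[OF assms] in auto)

lemma card_nbrs_nth:
  assumes "i < length zs"
  shows "card (parcs graph `` {zs ! i}) = card (neighbour_positions i) + card (L (zs ! i))"
proof -
  have fin: "finite (neighbour_positions i)" by (simp add: neighbour_positions_def)
  have "inj_on ((!) zs) (neighbour_positions i)"
    by (auto simp: inj_on_def neighbour_positions_def nth_eq_iff_index_eq[OF distinct_zs])
  moreover have "(!) zs ` neighbour_positions i \<inter> L (zs ! i) = {}"
    using leaf_not_spine[OF assms] by (auto simp: neighbour_positions_def)
  ultimately show ?thesis
    using fin finite_L assms by (simp add: nbrs_nth card_Un_disjoint card_image)
qed

lemma pair_graph_graph: "pair_graph graph"
proof -
  have sym: "(v, u) \<in> parcs graph" if "(u, v) \<in> parcs graph" for u v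
    using that
  proof (cases rule: arc_cases)
    case (spine i j)
    then have "i \<in> neighbour_positions j" by (auto simp: neighbour_positions_def)
    then show ?thesis using spine arc_spine by simp
  qed (use arc_to_leaf arc_from_leaf in auto)
  have irrefl: "u \<noteq> v" if "(u, v) \<in> parcs graph" for u v
    using that
  proof (cases rule: arc_cases)
    case (spine i j)
    then show ?thesis
      using nth_eq_iff_index_eq[OF distinct_zs, of i j] by (auto simp: neighbour_positions_def)
  qed (use leaf_not_spine in blast)+
  have sub: "u \<in> pverts graph" if "(u, v) \<in> parcs graph" for u v
    using that by (cases rule: arc_cases) (auto simp: pverts_graph)
  have fin: "finite (pverts graph)" using finite_L by (auto simp: pverts_graph)
  have "parcs graph \<subseteq> pverts graph \<times> pverts graph" using sub sym by auto
  then have "finite (parcs graph)" using fin finite_subset by blast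
  then show ?thesis
    using sym irrefl sub sub[OF sym] fin by unfold_locales (auto simp: symmetric_def sym_def)
qed

lemma sym_tree_graph: "sym_tree graph"
proof -
  interpret pair_graph graph by (rule pair_graph_graph)
  have spine: "zs ! i \<rightarrow>\<^sup>*\<^bsub>graph\<^esub> zs ! 0" if "i < length zs" for i
    using that
  proof (induction i)
    case (Suc i)
    have "(zs ! Suc i, zs ! i) \<in> parcs graph"
      using Suc.prems by (intro arc_spine) (auto simp: neighbour_positions_def)
    then show ?case using Suc adj_reachable_trans[of "zs ! Suc i" "zs ! i"] by simp
  qed (simp add: pverts_graph)
  have root: "v \<rightarrow>\<^sup>*\<^bsub>graph\<^esub> zs ! 0" if "v \<in> pverts graph" for v
    using that
  proof (cases v rule: pverts_cases)
    case (leaf i)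
    show ?thesis
      using arc_from_leaf[OF leaf] spine[OF leaf(1)] by (rule adj_reachable_trans)
  qed (use spine in simp)
  have "strongly_connected (with_proj graph)"
    unfolding strongly_connected_def with_proj_simps
    using reachable_trans[OF root symmetric_reachable'[OF root]] nth_in_pverts[of 0] zs_nonempty
    by blast
  then have conn: "connected (with_proj graph)"
    unfolding connected_def strongly_connected_def
    using reachable_mk_symmetric_eq[OF pair_sym_arcs] by simp
  \<comment> \<open>Ranks grow along the spine and leaves lie above it, so a vertex has at most one
    neighbour of no larger rank: its predecessor on the spine, or the attachment vertex of a
    leaf.\<close>
  define rank where "rank v = (if v \<in> set zs then position v else length zs)" for v
  have rank_nth: "rank (zs ! i) = i" if "i < length zs" for i
    using that by (simp add: rank_def position_nth)
  have rank_leaf: "rank x = length zs" if "i < length zs" "x \<in> L (zs ! i)" for x i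
    using that L_disjoint_zs[of "zs ! i"] by (auto simp: rank_def)
  have "length c < 3" if "cycle c" for c
    using _ that
  proof (rule no_long_cycle_if_rank)
    fix v w w' assume *: "(v, w) \<in> parcs graph" "(v, w') \<in> parcs graph"
      "rank w \<le> rank v" "rank w' \<le> rank v"
    from in_arcsD1[OF *(1)] show "w = w'"
    proof (cases rule: pverts_cases)
      case (spine i)
      \<comment> \<open>For \<open>i = 0\<close> no neighbour satisfies the rank condition, so the
        truncated index does no harm.\<close>
      have "u = zs ! (i - 1)" if "(v, u) \<in> parcs graph" "rank u \<le> rank v" for u
      proof -
        have "u \<in> (!) zs ` neighbour_positions i \<union> L (zs ! i)"
          using that(1) nbrs_nth[OF spine(1)] spine(2) by auto
        then show ?thesis
          using that(2) spine rank_nth rank_leaf by (fastforce simp: neighbour_positions_def)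
      qed
      then show ?thesis using * by metis
    next
      case (leaf i)
      have "w \<in> parcs graph `` {v}" "w' \<in> parcs graph `` {v}" using * by auto
      then show ?thesis by (simp add: nbrs_leaf[OF leaf])
    qed
  qed
  then show ?thesis
    unfolding sym_tree_def using conn pair_graph_graph by (meson not_less)
qed

sublocale tree_distance "pverts graph" "parcs graph" "walk_dist graph"
  by (rule sym_tree_tree_distance[OF sym_tree_graph])

section \<open>Distances and eccentricities in a caterpillar\<close>

lemma position_step:
  assumes "(v, w) \<in> parcs graph"
  shows "\<bar>int (position v) - int (position w)\<bar> \<le> 1"
  using assms
  by (cases rule: arc_cases) (auto simp: neighbour_positions_def position_nth position_leaf)

lemma dist_spine_le:
  assumes "i + m < length zs"
  shows "walk_dist graph (zs ! (i + m)) (zs ! i) \<le> m"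
  using assms
proof (induction m)
  case (Suc m)
  have "(zs ! (i + m), zs ! (i + Suc m)) \<in> parcs graph"
    using Suc.prems by (intro arc_spine) (auto simp: neighbour_positions_def)
  then show ?case
    using Suc d_step[of "zs ! (i + m)" "zs ! (i + Suc m)" "zs ! i"] nth_in_pverts[of i] by auto
qed (simp add: d_self nth_in_pverts)

text \<open>Walking along the spine gives the upper bound, the potential \<open>position\<close> the
  lower one.\<close>

lemma dist_spine:
  assumes "i \<le> j" "j < length zs"
  shows "walk_dist graph (zs ! j) (zs ! i) = j - i"
proof (rule le_antisym)
  show "walk_dist graph (zs ! j) (zs ! i) \<le> j - i"
    using dist_spine_le[of i "j - i"] assms by simp
  show "j - i \<le> walk_dist graph (zs ! j) (zs ! i)"
    using potential_le_d[of "\<lambda>v. int (position v)" "zs ! j" "zs ! i"] position_step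
      nth_in_pverts[of i] nth_in_pverts[of j] assms
    by (simp add: position_nth)
qed

lemma dist_spine':
  assumes "i \<le> j" "j < length zs"
  shows "walk_dist graph (zs ! i) (zs ! j) = j - i"
  using dist_spine[OF assms] d_sym nth_in_pverts assms by simp

lemma dist_leaf_spine:
  assumes "y \<in> L (zs ! j)" "i < length zs" "j < length zs"
  shows "walk_dist graph y (zs ! i) = Suc (walk_dist graph (zs ! j) (zs ! i))"
  using assms leaf_not_spine[OF assms(3,1,2)]
  by (intro d_pendant nbrs_leaf nth_in_pverts) auto

lemma dist_leaf_leaf:
  assumes "x \<in> L (zs ! i)" "y \<in> L (zs ! j)" "x \<noteq> y" "i < length zs" "j < length zs"
  shows "walk_dist graph x y = Suc (Suc (walk_dist graph (zs ! i) (zs ! j)))"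
proof -
  have "walk_dist graph x y = Suc (walk_dist graph (zs ! i) y)"
    using assms by (intro d_pendant nbrs_leaf leaf_in_pverts[of j]) auto
  also have "walk_dist graph (zs ! i) y = walk_dist graph y (zs ! i)"
    using assms by (intro d_sym nth_in_pverts leaf_in_pverts[of j]) auto
  finally show ?thesis
    using dist_leaf_spine[OF assms(2,4,5)] d_sym[OF nth_in_pverts nth_in_pverts] assms(4,5) by simp
qed

text \<open>A leaf hanging from either end of the spine lies one step beyond that end. Lower bounds
  on eccentricities yield the upper bound on the index.\<close>

lemma ecc_spine_ge:
  assumes "L (zs ! 0) \<noteq> {}" "L (zs ! (length zs - 1)) \<noteq> {}" "i < length zs"
  shows "max (Suc i) (length zs - i) \<le> ecc (zs ! i)"
proof -
  let ?l = "length zs - 1"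
  have l: "0 < length zs" "?l < length zs" "i \<le> ?l" using assms(3) by auto
  have *: "Suc (walk_dist graph (zs ! j) (zs ! i)) \<le> ecc (zs ! i)"
    if "y \<in> L (zs ! j)" "j < length zs" for y j
    using d_le_ecc[of y "zs ! i"] d_sym[of y "zs ! i"] dist_leaf_spine[OF that(1) assms(3) that(2)]
      leaf_in_pverts[OF that(2,1)] nth_in_pverts[OF assms(3)] by simp
  obtain y y' where "y \<in> L (zs ! 0)" "y' \<in> L (zs ! ?l)" using assms(1,2) by blast
  then have "Suc i \<le> ecc (zs ! i)" "Suc (?l - i) \<le> ecc (zs ! i)"
    using *[OF _ l(1)] *[OF _ l(2)] dist_spine'[of 0 i] dist_spine[of i ?l] l assms(3) by auto
  then show ?thesis using assms(3) by auto
qed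

text \<open>The witness is a leaf at the farther end of the spine. It must differ from
  \<open>x\<close>, which for a spine of one vertex calls for a second leaf there.\<close>

lemma ecc_leaf_ge:
  assumes "L (zs ! 0) \<noteq> {}" "L (zs ! (length zs - 1)) \<noteq> {}"
    and "length zs = 1 \<Longrightarrow> 2 \<le> card (L (zs ! 0))"
    and i: "i < length zs" "x \<in> L (zs ! i)"
  shows "Suc (max (Suc i) (length zs - i)) \<le> ecc x"
proof -
  have *: "Suc (Suc (walk_dist graph (zs ! i) (zs ! j))) \<le> ecc x"
    if j: "j < length zs" "j \<noteq> i \<or> length zs = 1" "L (zs ! j) \<noteq> {}" for j
  proof -
    have "\<exists>y\<in>L (zs ! j). x \<noteq> y"
    proof (cases "j = i")
      case True
      then have "2 \<le> card (L (zs ! j))" using j assms(3) by simp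
      then have "\<not> L (zs ! j) \<subseteq> {x}" using card_mono[of "{x}" "L (zs ! j)"] by auto
      then show ?thesis by (metis singleton_iff subsetI)
    next
      case False
      obtain y where "y \<in> L (zs ! j)" using j(3) by blast
      then show ?thesis using leaf_unique[OF i j(1)] False by metis
    qed
    then obtain y where y: "y \<in> L (zs ! j)" "x \<noteq> y" by blast
    then show ?thesis
      using d_le_ecc[OF leaf_in_pverts[OF j(1) y(1)], of x] dist_leaf_leaf[OF i(2) y(1,2) i(1) j(1)]
      by simp
  qed
  show ?thesis
  proof (cases "length zs - i \<le> Suc i")
    case True
    then have "0 \<noteq> i \<or> length zs = 1" using i(1) by linarith
    then show ?thesis
      using True *[of 0] assms(1) dist_spine[of 0 i] i(1) zs_nonempty by auto
  next
    case False
    then have "length zs - 1 \<noteq> i" "length zs - 1 < length zs" "i \<le> length zs - 1"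
      using i(1) by auto
    then show ?thesis
      using False *[of "length zs - 1"] assms(2) dist_spine'[of i "length zs - 1"] i(1) by auto
  qed
qed

end

text \<open>The path is a caterpillar without leaves. The formula turns the greedy condition into
  one about positions.\<close>

lemma eccentricity_path_graph:
  assumes "distinct zs" "i < length zs"
  shows "eccentricity (path_graph zs) (zs ! i) = real (max i (length zs - 1 - i))"
proof -
  interpret caterpillar zs "\<lambda>_. {}"
    using assms by unfold_locales auto
  have graph: "graph = path_graph zs"
    by (simp add: graph_def attach_pendants_def)
  have pverts: "pverts graph = set zs" by (simp add: pverts_graph)
  have "ecc (zs ! i) = max i (length zs - 1 - i)"
  proof (rule le_antisym)
    show "ecc (zs ! i) \<le> max i (length zs - 1 - i)"
    proof (rule ecc_le)
      fix x assume "x \<in> pverts graph"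
      then obtain j where "j < length zs" "x = zs ! j" by (auto simp: pverts in_set_conv_nth)
      then show "walk_dist graph (zs ! i) x \<le> max i (length zs - 1 - i)"
        using dist_spine[of j i] dist_spine'[of i j] assms(2) by (cases "i \<le> j") auto
    qed
    show "max i (length zs - 1 - i) \<le> ecc (zs ! i)"
      using d_le_ecc[OF nth_in_pverts, of 0 "zs ! i"]
        d_le_ecc[OF nth_in_pverts, of "length zs - 1" "zs ! i"]
        dist_spine[of 0 i] dist_spine'[of i "length zs - 1"] assms(2) zs_nonempty by auto
  qed
  then show ?thesis
    using sym_tree_eccentricity[OF sym_tree_graph nth_in_pverts[OF assms(2)]] by (simp add: graph)
qed

section \<open>Harmonic sums along a spine\<close>

lemma sum_inverse_path_ecc:
  "(\<Sum>i<k. 1 / real (max (Suc i) (k - i))) =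
    2 * (\<Sum>i<k. 1 / real (Suc i)) - (\<Sum>i<k div 2. 1 / real (Suc i)) -
      (\<Sum>i<(k + 1) div 2. 1 / real (Suc i))"
proof -
  let ?m = "k div 2" and ?m' = "(k + 1) div 2"
  have split: "(\<Sum>i<k. f i) = (\<Sum>i<m. f i) + (\<Sum>i = m..<k. f i)" if "m \<le> k"
    for f :: "nat \<Rightarrow> real" and m
    using sum.atLeastLessThan_concat[of 0 m k f] that by (simp add: atLeast0LessThan)
  \<comment> \<open>The reflection \<open>i \<mapsto> k - 1 - i\<close> folds the first half of the
    spine onto the last positions, where the maximum is \<open>Suc i\<close>.\<close>
  have "(\<Sum>i<?m. 1 / real (max (Suc i) (k - i))) = (\<Sum>i = ?m'..<k. 1 / real (Suc i))"
    by (rule sum.reindex_bij_witness[of _ "\<lambda>i. k - Suc i" "\<lambda>i. k - Suc i"]) (auto simp: max_def)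
  moreover have "(\<Sum>i = ?m..<k. 1 / real (max (Suc i) (k - i))) = (\<Sum>i = ?m..<k. 1 / real (Suc i))"
    by (rule sum.cong) (auto simp: max_def)
  moreover have "?m \<le> k" "?m' \<le> k" by presburger+
  ultimately show ?thesis
    using split[of ?m "\<lambda>i. 1 / real (max (Suc i) (k - i))"]
      split[of ?m "\<lambda>i. 1 / real (Suc i)"] split[of ?m' "\<lambda>i. 1 / real (Suc i)"] by linarith
qed

lemma card_path_neighbours:
  assumes "i < k"
  shows "card {j. j < k \<and> (j = Suc i \<or> i = Suc j)} =
    (if i = 0 then 0 else 1) + (if i = k - 1 then 0 else 1)"
proof -
  have "{j. j < k \<and> (j = Suc i \<or> i = Suc j)} =
      (if i = 0 then {} else {i - 1}) \<union> (if i = k - 1 then {} else {Suc i})"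
    using assms by auto
  then show ?thesis by auto
qed

text \<open>This is the part of the caterpillar's index that does not depend on the degrees. It
  turns out to equal the central term of the lower bound at diameter \<open>k + 1\<close>, so the
  two bounds meet.\<close>

lemma spine_correction:
  fixes k :: nat
  defines "e \<equiv> \<lambda>i. max (Suc i) (k - i)"
  assumes "0 < k"
  shows "(\<Sum>i<k. 1 / e i + (1 - real (card {j. j < k \<and> (j = Suc i \<or> i = Suc j)})) / Suc (e i)) =
    1 / real ((k + 2) div 2) + 1 / real ((k + 1) div 2 + 1)"
proof -
  let ?S = "\<lambda>k. \<Sum>i<k. 1 / real (max (Suc i) (k - i))"
  \<comment> \<open>An inner position has two neighbours; each coincidence of \<open>i\<close> with
    an end removes one. The case \<open>k = 1\<close> is covered, both ends then being the same
    position.\<close>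
  have b: "1 - real (card {j. j < k \<and> (j = Suc i \<or> i = Suc j)}) =
      (if i = 0 then 1 else 0) + (if i = k - 1 then 1 else 0) - 1" if "i < k" for i
    by (simp add: card_path_neighbours[OF that])
  have "(\<Sum>i<k. 1 / e i + (1 - real (card {j. j < k \<and> (j = Suc i \<or> i = Suc j)})) / Suc (e i)) =
      (\<Sum>i<k. 1 / e i + ((if i = 0 then 1 / Suc (e i) else 0) +
        (if i = k - 1 then 1 / Suc (e i) else 0) - 1 / Suc (e i)))"
    by (intro sum.cong refl, subst b) (simp_all add: add_divide_distrib diff_divide_distrib)
  also have "\<dots> = ?S k + (1 / Suc (e 0) + 1 / Suc (e (k - 1)) - (\<Sum>i<k. 1 / Suc (e i)))"
    using assms(2) by (simp add: sum.distrib sum_subtractf e_def)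
  also have "\<dots> = ?S k + 2 / (k + 1) - (\<Sum>i<k. 1 / Suc (e i))"
    using assms(2) by (simp add: e_def)
  \<comment> \<open>\<open>Suc (e i)\<close> is the spine value at position \<open>i + 1\<close>
    among \<open>k + 2\<close> positions, whose two extra ends contribute \<open>1 / (k + 2)\<close>
    each. What remains is a difference of two harmonic expressions.\<close>
  also have "(\<Sum>i<k. 1 / Suc (e i)) = ?S (k + 2) - 2 / (k + 2)"
  proof -
    have "?S (k + 2) = 1 / real (k + 2) + (\<Sum>i<k. 1 / real (max (Suc (Suc i)) (Suc k - i))) + 1 / real (k + 2)"
      by (simp only: add_2_eq_Suc' sum.lessThan_Suc[of _ "Suc k"] sum.lessThan_Suc_shift[of _ k]) simp
    also have "(\<Sum>i<k. 1 / real (max (Suc (Suc i)) (Suc k - i))) = (\<Sum>i<k. 1 / Suc (e i))"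
      by (rule sum.cong) (auto simp: e_def Suc_diff_le)
    finally show ?thesis by simp
  qed
  finally show ?thesis
    unfolding sum_inverse_path_ecc by (simp add: add.commute)
qed

section \<open>Upper bound for the index of a caterpillar\<close>

context caterpillar
begin

lemma sum_spine: "(\<Sum>z\<in>set zs. f z) = (\<Sum>i<length zs. f (zs ! i))"
  by (rule sum.reindex_bij_betw[OF bij_betw_nth[OF distinct_zs], symmetric]) auto

lemma sum_pverts:
  fixes f :: "'a \<Rightarrow> 'b::comm_monoid_add"
  shows "(\<Sum>v\<in>pverts graph. f v) = (\<Sum>i<length zs. f (zs ! i) + (\<Sum>x\<in>L (zs ! i). f x))"
proof -
  have "(\<Sum>v\<in>pverts graph. f v) = (\<Sum>z\<in>set zs. f z) + (\<Sum>v\<in>(\<Union>z\<in>set zs. L z). f v)"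
    unfolding pverts_graph using finite_L L_disjoint_zs by (intro sum.union_disjoint) auto
  also have "(\<Sum>v\<in>(\<Union>z\<in>set zs. L z). f v) = (\<Sum>z\<in>set zs. \<Sum>x\<in>L z. f x)"
    using finite_L L_disjoint by (intro sum.UNION_disjoint) auto
  finally show ?thesis by (simp add: sum_spine sum.distrib)
qed

lemma deg_nth:
  "i < length zs \<Longrightarrow> deg (zs ! i) = card (neighbour_positions i) + card (L (zs ! i))"
  by (simp add: deg_def card_nbrs_nth)

lemma deg_leaf: "i < length zs \<Longrightarrow> x \<in> L (zs ! i) \<Longrightarrow> deg x = 1"
  by (simp add: deg_def nbrs_leaf)

text \<open>Group the sum by spine position: the vertex contributes at most \<open>deg / e\<close>
  and each of its leaves at most \<open>1 / Suc e\<close>. The number of leaves is the degree minus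
  the number of spine neighbours, so the sum splits into the main term of the lower bound and
  \<open>spine_correction\<close>.\<close>

lemma index_upper_bound:
  defines "k \<equiv> length zs"
  defines "e \<equiv> \<lambda>i. max (Suc i) (k - i)"
  assumes ends: "L (zs ! 0) \<noteq> {}" "L (zs ! (k - 1)) \<noteq> {}" "k = 1 \<Longrightarrow> 2 \<le> card (L (zs ! 0))"
  shows "(\<Sum>v\<in>pverts graph. real (deg v) / ecc v) \<le>
    (\<Sum>i<k. real (deg (zs ! i) - 1) * (1 / e i + 1 / Suc (e i))) +
      (1 / real ((k + 2) div 2) + 1 / real ((k + 1) div 2 + 1))"
proof -
  have k: "0 < k" using zs_nonempty by (simp add: k_def)
  have e_pos: "0 < e i" for i by (simp add: e_def)
  have "(\<Sum>v\<in>pverts graph. real (deg v) / ecc v) =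
      (\<Sum>i<k. deg (zs ! i) / ecc (zs ! i) + (\<Sum>x\<in>L (zs ! i). deg x / ecc x))"
    unfolding k_def by (rule sum_pverts)
  also have "\<dots> \<le> (\<Sum>i<k. deg (zs ! i) / e i + card (L (zs ! i)) / Suc (e i))"
  proof (intro sum_mono add_mono)
    fix i assume i: "i \<in> {..<k}"
    have "e i \<le> ecc (zs ! i)"
      using ecc_spine_ge ends i by (simp add: e_def k_def)
    then show "deg (zs ! i) / ecc (zs ! i) \<le> deg (zs ! i) / e i"
      using e_pos[of i] by (intro divide_left_mono) auto
    have "(\<Sum>x\<in>L (zs ! i). deg x / ecc x) \<le> (\<Sum>x\<in>L (zs ! i). 1 / Suc (e i))"
    proof (rule sum_mono)
      fix x assume x: "x \<in> L (zs ! i)"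
      have "Suc (e i) \<le> ecc x"
        using ecc_leaf_ge[OF _ _ _ _ x] ends i by (simp add: e_def k_def)
      then show "deg x / ecc x \<le> 1 / Suc (e i)"
        using deg_leaf[OF _ x] i by (intro frac_le) (auto simp: k_def)
    qed
    then show "(\<Sum>x\<in>L (zs ! i). deg x / ecc x) \<le> card (L (zs ! i)) / Suc (e i)" by simp
  qed
  also have "\<dots> = (\<Sum>i<k. real (deg (zs ! i) - 1) * (1 / e i + 1 / Suc (e i)) +
      (1 / e i + (1 - real (card (neighbour_positions i))) / Suc (e i)))"
  proof (intro sum.cong refl)
    fix i assume i: "i \<in> {..<k}"
    obtain x where x: "x \<in> L (zs ! 0)" using ends by blast
    have "card {zs ! 0, x} \<le> card (pverts graph)"
      using x k finite_V by (intro card_mono) (auto simp: pverts_graph k_def)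
    then have "2 \<le> card (pverts graph)"
      using leaf_not_spine[OF _ x, of 0] k by (simp add: k_def)
    then have "0 < deg (zs ! i)"
      using deg_pos i nth_in_pverts by (simp add: k_def)
    \<comment> \<open>Positivity of the degree makes the truncated subtraction exact.\<close>
    then have d: "real (deg (zs ! i) - 1) = real (deg (zs ! i)) - 1" by simp
    have l: "real (card (L (zs ! i))) = deg (zs ! i) - real (card (neighbour_positions i))"
      using i by (simp add: deg_nth k_def)
    have alg: "D / a + (D - N) / s = (D - 1) * (1 / a + 1 / s) + (1 / a + (1 - N) / s)"
      for D N a s :: real
      by (simp add: diff_divide_distrib distrib_left left_diff_distrib)
    show "deg (zs ! i) / e i + card (L (zs ! i)) / Suc (e i) =
        real (deg (zs ! i) - 1) * (1 / e i + 1 / Suc (e i)) +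
        (1 / e i + (1 - real (card (neighbour_positions i))) / Suc (e i))"
      unfolding d l by (rule alg)
  qed
  also have "\<dots> = (\<Sum>i<k. real (deg (zs ! i) - 1) * (1 / e i + 1 / Suc (e i))) +
      (1 / real ((k + 2) div 2) + 1 / real ((k + 1) div 2 + 1))"
    unfolding sum.distrib[of "\<lambda>i. real (deg (zs ! i) - 1) * (1 / e i + 1 / Suc (e i))"]
    using spine_correction[OF k] by (simp only: neighbour_positions_def e_def k_def)
  finally show ?thesis .
qed

end

section \<open>Minimality\<close>

lemma degree_sequence_card:
  assumes "has_degree_sequence G ds"
  shows "card (pverts G) = length ds"
  using arg_cong[OF assms[unfolded has_degree_sequence_def], of size] by simp

lemma tree_degree_sequence_sum:
  assumes "tree_degree_sequence ds"
  shows "sum_list ds + 2 = 2 * length ds"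
proof -
  obtain T :: "nat pair_pre_digraph" where T: "sym_tree T" "has_degree_sequence T ds"
    using assms by (auto simp: tree_degree_sequence_def)
  interpret tree_distance "pverts T" "parcs T" "walk_dist T"
    using T(1) by (rule sym_tree_tree_distance)
  have "deg = degree T" by (auto simp: deg_def degree_eq_card_nbrs)
  then have "(\<Sum>v\<in>pverts T. deg v) = sum_list ds"
    using T(2) by (simp add: has_degree_sequence_def sum_unfold_sum_mset sum_mset_sum_list)
  then show ?thesis using handshake degree_sequence_card[OF T(2)] by simp
qed

lemma tree_degree_sequence_pos:
  assumes "tree_degree_sequence ds" "2 \<le> length ds" "x \<in> set ds"
  shows "0 < x"
proof -
  obtain T :: "nat pair_pre_digraph" where T: "sym_tree T" "has_degree_sequence T ds"
    using assms by (auto simp: tree_degree_sequence_def)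
  interpret tree_distance "pverts T" "parcs T" "walk_dist T"
    using T(1) by (rule sym_tree_tree_distance)
  have "x \<in># image_mset (degree T) (mset_set (pverts T))"
    using assms(3) T(2) by (simp add: has_degree_sequence_def)
  then obtain v where "v \<in> pverts T" "x = deg v"
    using finite_V by (auto simp: deg_def degree_eq_card_nbrs)
  then show ?thesis using deg_pos assms(2) degree_sequence_card[OF T(2)] by simp
qed

theorem theorem3p2:
  fixes ds :: "nat list" and n k :: nat
    and C :: "'a pair_pre_digraph"
  assumes "n \<ge> 3" and "length ds = n"
    and "sorted_wrt (\<ge>) ds"
    and "tree_degree_sequence ds"
    and "k \<in> {1..n - 2}" and "ds ! (k - 1) > 1" and "ds ! k = 1"
    and "greedy_caterpillar ds k C"
  shows "sym_tree C \<and> has_degree_sequence C ds \<and>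
    (\<forall>T :: 'b pair_pre_digraph. sym_tree T \<and> has_degree_sequence T ds \<longrightarrow>
       connective_eccentricity_index C \<le> connective_eccentricity_index T)"
proof -
  have k: "0 < k" "k < n" using assms(1,5) by auto
  have anti: "ds ! j \<le> ds ! i" if "i \<le> j" "j < n" for i j
    using that assms(2) sorted_wrt_nth_less[OF assms(3), of i j] by (cases "i = j") auto
  have take_ge: "2 \<le> d" if d: "d \<in> set (take k ds)" for d
  proof -
    obtain i where "i < k" "d = ds ! i"
      using d k assms(2) by (auto simp: in_set_conv_nth)
    then show ?thesis using anti[of i "k - 1"] k assms(6) by simp linarith
  qed
  \<comment> \<open>These entries are at most \<open>ds ! k = 1\<close> by monotonicity and positive
    as degrees of a tree with more than one vertex.\<close>
  have "drop k ds = replicate (n - k) 1"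
  proof (rule nth_equalityI)
    fix i assume "i < length (drop k ds)"
    then have i: "k + i < n" using assms(2) by simp
    then have "0 < ds ! (k + i)"
      using tree_degree_sequence_pos[OF assms(4)] assms(1,2) by simp
    then show "drop k ds ! i = replicate (n - k) 1 ! i"
      using anti[of k "k + i"] i assms(2,7) by simp
  qed (use assms(2) in simp)
  then have ds: "ds = take k ds @ replicate (n - k) 1"
    by (metis append_take_drop_id)

  obtain zs \<phi> L where zs: "length zs = k" "distinct zs"
    and phi: "image_mset \<phi> (mset zs) = mset (take k ds)"
    and greedy: "\<forall>u\<in>set zs. \<forall>v\<in>set zs.
      eccentricity (path_graph zs) u > eccentricity (path_graph zs) v \<longrightarrow> \<phi> u \<ge> \<phi> v"
    and L: "\<forall>i<k. finite (L (zs ! i)) \<and> card (L (zs ! i)) = num_pendants k i (\<phi> (zs ! i))"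
    and disj: "\<forall>u\<in>set zs. L u \<inter> set zs = {}"
      "\<forall>u\<in>set zs. \<forall>v\<in>set zs. u \<noteq> v \<longrightarrow> L u \<inter> L v = {}"
    and C: "C = attach_pendants (path_graph zs) L"
    using assms(8) unfolding greedy_caterpillar_def by (elim exE conjE) (rule that)
  interpret C: caterpillar zs L
    using zs k L disj by unfold_locales (auto simp: in_set_conv_nth)
  have C_graph: "C.graph = C" by (simp add: C C.graph_def)
  \<comment> \<open>With all assigned degrees at least two, no subtraction in
    \<open>num_pendants\<close> is truncated and both ends of the spine carry leaves.\<close>
  have phi_ge: "2 \<le> \<phi> z" if "z \<in> set zs" for z
  proof -
    have "\<phi> z \<in># image_mset \<phi> (mset zs)" using that by simp
    then show ?thesis unfolding phi using take_ge by simp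
  qed
  have deg_spine: "C.deg (zs ! i) = \<phi> (zs ! i)" if "i < k" for i
    using that phi_ge[of "zs ! i"] C.deg_nth[of i] L that zs(1)
    by (auto simp: C.neighbour_positions_def card_path_neighbours num_pendants_def)
  have ends: "L (zs ! 0) \<noteq> {}" "L (zs ! (k - 1)) \<noteq> {}" "k = 1 \<Longrightarrow> 2 \<le> card (L (zs ! 0))"
    using L[rule_format, of 0] L[rule_format, of "k - 1"] phi_ge[of "zs ! 0"] phi_ge[of "zs ! (k - 1)"] k zs(1)
    by (auto simp: num_pendants_def split: if_splits)

  have degree_C: "degree C = C.deg"
    by (rule ext) (simp add: degree_eq_card_nbrs C.deg_def flip: C_graph)
  define P where "P = (\<Union>z\<in>set zs. L z)"
  have P: "finite P" "P \<inter> set zs = {}" "pverts C = set zs \<union> P"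
    using C.finite_L C.L_disjoint_zs C.pverts_graph by (auto simp: P_def C_graph)
  have "image_mset C.deg (mset_set (set zs)) = image_mset \<phi> (mset_set (set zs))"
    using deg_spine zs(1) by (intro image_mset_cong) (auto simp: in_set_conv_nth)
  then have spine: "image_mset C.deg (mset_set (set zs)) = mset (take k ds)"
    using phi zs(2) by (simp add: mset_set_set)
  have leaves: "image_mset C.deg (mset_set P) = replicate_mset (card P) 1"
  proof -
    have "image_mset C.deg (mset_set P) = image_mset (\<lambda>_. 1) (mset_set P)"
      using P(1) C.deg_leaf by (intro image_mset_cong) (auto simp: P_def in_set_conv_nth)
    then show ?thesis by (simp add: image_mset_const_eq)
  qed
  have degs: "image_mset C.deg (mset_set (pverts C)) = mset (take k ds) + replicate_mset (card P) 1"
    using P spine leaves by (simp add: mset_set_Union Int_commute)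
  \<comment> \<open>The handshake identity for \<open>C\<close> and the same identity for
    \<open>ds\<close> differ only in the number of entries \<open>1\<close>, which they therefore
    determine.\<close>
  have "card P = n - k"
  proof -
    have "(\<Sum>v\<in>pverts C. C.deg v) = sum_list (take k ds) + card P"
      unfolding sum_unfold_sum_mset degs by (simp add: sum_mset_sum_list)
    moreover have "card (pverts C) = k + card P"
      using P zs distinct_card[OF zs(2)] by (simp add: card_Un_disjoint Int_commute)
    moreover have "sum_list ds = sum_list (take k ds) + (n - k)"
      by (subst ds) (simp add: sum_list_replicate)
    ultimately show ?thesis
      using C.handshake tree_degree_sequence_sum[OF assms(4)] assms(2) k by (simp add: C_graph)
  qed
  moreover have "mset ds = mset (take k ds) + replicate_mset (n - k) 1"
    by (subst ds) simp
  ultimately have deg_seq: "has_degree_sequence C ds"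
    using degs by (simp add: has_degree_sequence_def degree_C)

  \<comment> \<open>One more than the eccentricity in the bare path, because of the leaves beyond
    its ends.\<close>
  define e where "e i = max (Suc i) (k - i)" for i
  have "connective_eccentricity_index C \<le> connective_eccentricity_index T"
    if T: "sym_tree T" "has_degree_sequence T ds" for T :: "'b pair_pre_digraph"
  proof -
    interpret T: tree_distance "pverts T" "parcs T" "walk_dist T"
      using T(1) by (rule sym_tree_tree_distance)
    have degree_T: "degree T = T.deg" by (auto simp: degree_eq_card_nbrs T.deg_def)
    \<comment> \<open>The internal vertices of \<open>T\<close> are those of degree at least two, so
      their degrees are exactly the first \<open>k\<close> entries of \<open>ds\<close>.\<close>
    have "image_mset T.deg (mset_set T.internal) = filter_mset (\<lambda>d. 2 \<le> d) (mset ds)"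
      using T(2) T.finite_V
      by (simp add: has_degree_sequence_def degree_T T.internal_def image_mset_filter_mset_swap
        flip: filter_mset_mset_set)
    also have "\<dots> = mset (filter (\<lambda>d. 2 \<le> d) ds)" by simp
    also have "filter (\<lambda>d. 2 \<le> d) ds = take k ds"
      using arg_cong[OF ds, of "filter (\<lambda>d. 2 \<le> d)"] take_ge by (simp add: filter_id_conv)
    also have "mset (take k ds) = image_mset \<phi> (mset_set (set zs))"
      using phi zs(2) by (simp add: mset_set_set)
    finally obtain h where h: "bij_betw h (set zs) T.internal" "\<And>z. z \<in> set zs \<Longrightarrow> T.deg (h z) = \<phi> z"
      using image_mset_eq_imp_bij_betw[OF _ T.finite_internal, of "set zs" \<phi> T.deg] by auto
    \<comment> \<open>The internal vertex of \<open>T\<close> matched with \<open>zs ! i\<close>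
      takes position \<open>i\<close>; both trees then have the same degree at every position and
      the same main sum.\<close>
    define \<pi> where "\<pi> i = h (zs ! i)" for i
    have deg_pi: "T.deg (\<pi> i) = \<phi> (zs ! i)" if "i < k" for i
      using h(2) that zs(1) by (simp add: \<pi>_def)
    have "bij_betw (h \<circ> (!) zs) {..<k} T.internal"
      using zs h(1) by (intro bij_betw_trans[OF bij_betw_nth]) auto
    then have bij: "bij_betw \<pi> {..<k} T.internal" by (simp add: comp_def flip: \<pi>_def)
    have mono: "T.deg (\<pi> i) \<le> T.deg (\<pi> j)" if "i < k" "j < k" "e i < e j" for i j
    proof -
      have "max i (k - 1 - i) < max j (k - 1 - j)"
        using that by (auto simp: e_def max_def split: if_splits)
      then show ?thesis
        using greedy[rule_format, of "zs ! j" "zs ! i"] that zs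
        by (simp add: deg_pi eccentricity_path_graph del: of_nat_max)
    qed
    have "connective_eccentricity_index C \<le>
        (\<Sum>i<k. real (C.deg (zs ! i) - 1) * (1 / e i + 1 / Suc (e i))) +
        (1 / real ((k + 2) div 2) + 1 / real ((k + 1) div 2 + 1))"
      using C.index_upper_bound[unfolded zs(1), OF ends] sym_tree_index[OF C.sym_tree_graph]
      by (simp only: C_graph e_def)
    also have "(\<Sum>i<k. real (C.deg (zs ! i) - 1) * (1 / e i + 1 / Suc (e i))) =
        (\<Sum>i<k. real (T.deg (\<pi> i) - 1) * (1 / e i + 1 / Suc (e i)))"
      by (rule sum.cong) (simp_all add: deg_spine deg_pi)
    also have "\<dots> + (1 / real ((k + 2) div 2) + 1 / real ((k + 1) div 2 + 1)) \<le>
        connective_eccentricity_index T"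
      unfolding sym_tree_index[OF T(1)] e_def
      by (rule T.index_lower_bound[OF _ bij])
        (use mono degree_sequence_card[OF T(2)] assms(1,2) in \<open>auto simp: e_def\<close>)
    finally show ?thesis .
  qed
  then show ?thesis using C.sym_tree_graph deg_seq by (simp add: C_graph)
qed

end
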